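(* Let $d\ge 1$ and define the double layer heat kernel $$D(x,y;t)=\frac{(x-y)\cdot n_y}{(4\pi t)^{d/2}\,2t}\,e^{-|x-y|^2/(4t)},\qquad x,y\in\mathbb{R}^d,\ t>0,$$ where $n_y\in\mathbb{R}^d$ is a unit vector (the unit normal at $y$). There is a constant $C_d>0$ such that for every $0<\epsilon<0.1$, every $R>1$ and every $T\ge 1000\delta>0$ there exist positive integers $$N_1\le C_d\log\frac{T}{\delta}\left(\log\frac1\epsilon+\log\log\frac{T}{\delta}+\log R\right),\qquad N_2\le C_d\left(\log\frac1\epsilon+\log R\right)\left(\log\frac{T}{\delta}+\log\frac1\epsilon+\log R\right),$$ positive reals $\tilde w_j,\lambda_j$ ($j=1,\dots,N_2$), and complex numbers $w_k$ and $s_k\in\mathbb{C}\setminus(-\infty,0]$ ($k=-N_1,\dots,N_1$) such that $$D_A(x,y;t)=\sum_{j=1}^{N_2}\tilde w_j e^{-\lambda_j t}\sum_{k=-N_1}^{N_1}w_k e^{s_k t}e^{-\sqrt{s_k}|x-y|}\,(x-y)\cdot n_y$$ satisfies $|D(x,y;t)-D_A(x,y;t)|<\frac{\epsilon}{t^{(d+2)/2}}$ for all $x,y\in\mathbb{R}^d$ with $|x-y|\le R$, all unit vectors $n_y$, and all $t\in[\delta,T]$.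
   Context: $|\cdot|$ is the Euclidean norm and $\cdot$ the Euclidean inner product on $\mathbb{R}^d$; $\sqrt{s}$ denotes the principal branch of the square root on $\mathbb{C}\setminus(-\infty,0]$. *)

theory Defs
  imports "HOL-Analysis.Analysis"
begin

definition double_layer_heat :: "'a::euclidean_space \<Rightarrow> 'a \<Rightarrow> 'a \<Rightarrow> real \<Rightarrow> real" where
  "double_layer_heat x y n t =
     ((x - y) \<bullet> n) / ((4 * pi * t) powr (real DIM('a) / 2) * (2 * t))
       * exp (- (norm (x - y))\<^sup>2 / (4 * t))"

definition double_layer_approx ::
  "nat \<Rightarrow> (nat \<Rightarrow> real) \<Rightarrow> (nat \<Rightarrow> real) \<Rightarrow> nat \<Rightarrow> (int \<Rightarrow> complex) \<Rightarrow> (int \<Rightarrow> complex)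
     \<Rightarrow> 'a::euclidean_space \<Rightarrow> 'a \<Rightarrow> 'a \<Rightarrow> real \<Rightarrow> complex" where
  "double_layer_approx N2 wt lam N1 w s x y n t =
     (\<Sum>j\<in>{1..N2}. complex_of_real (wt j * exp (- lam j * t)) *
        (\<Sum>k\<in>{- int N1..int N1}. w k * exp (s k * complex_of_real t)
            * exp (- csqrt (s k) * complex_of_real (norm (x - y)))
            * complex_of_real ((x - y) \<bullet> n)))"

end

theory Submission
  imports
    Defs
    "HOL-Complex_Analysis.Cauchy_Integral_Formula"
    "HOL-Probability.Characteristic_Functions"
begin

text \<open>
  Up to a constant and the factor \<open>(x - y) \<bullet> n\<close>, the kernel is the product of \<open>t powr (- (d + 1) / 2)\<close>
  and the profile \<open>exp (- r\<^sup>2 / (4 t)) / sqrt t\<close> with \<open>r = norm (x - y)\<close>, and each factor is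
  approximated with small relative error by the trapezoidal rule applied to an entire integrand.

  For the power of \<open>t\<close> the integral is \<open>Gamma \<beta> * t powr (- \<beta>) = \<integral> exp (\<beta> u - t exp u) du\<close>.
  For the profile it is the inverse Laplace transform of \<open>exp (- r sqrt s) / sqrt s\<close>, taken in the
  variable \<open>z = sqrt s\<close> along the hyperbola \<open>z = a cosh (u + \<i> \<phi>)\<close> with \<open>pi / 4 < \<phi> < pi / 2\<close>: there
  \<open>Re z > 0\<close>, so \<open>exp (- z r)\<close> is bounded, while \<open>exp (z\<^sup>2 t)\<close> decays doubly exponentially in \<open>u\<close>.
  The choice \<open>a\<^sup>2 = L / T\<close> with \<open>L\<close> of the size of \<open>ln (R / \<epsilon>)\<close> costs a factor \<open>exp L\<close>, which the
  trapezoidal rule compensates, and makes a range of \<open>u\<close> of length \<open>O (ln (T / \<delta>))\<close> sufficient.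
\<close>

section \<open>The trapezoidal rule for entire functions\<close>

text \<open>Follows from \<open>fact j \<le> j ^ j\<close>. It tames the factorials of Cauchy's
  inequality: with \<open>q = h / v\<close> the quantity is \<open>h ^ j\<close> times the factor
  \<open>fact j / v ^ j\<close>.\<close>

lemma fact_times_power_le_one:
  fixes q :: real
  assumes "0 \<le> q" "real j * q \<le> 1"
  shows "fact j * q ^ j \<le> 1"
proof -
  have "fact j * q ^ j \<le> real (j ^ j) * q ^ j"
    using assms by (intro mult_right_mono) (auto intro: fact_le_power simp del: of_nat_power)
  also have "\<dots> = (real j * q) ^ j"
    by (simp add: power_mult_distrib)
  also have "\<dots> \<le> 1"
    using assms by (intro power_le_one) auto
  finally show ?thesis .
qed

text \<open>The left side is the norm of the integral of \<open>G x - G y\<close> over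
  \<open>y\<close>, and each such difference is at most \<open>h * S\<close> by the mean value
  inequality.\<close>

lemma norm_diff_integral_le_deriv:
  fixes G G' :: "real \<Rightarrow> complex"
  assumes h: "0 \<le> h" and x: "x \<in> {0..h}"
    and deriv: "\<And>x. x \<in> {0..h} \<Longrightarrow> (G has_vector_derivative G' x) (at x within {0..h})"
    and bound: "\<And>x. x \<in> {0..h} \<Longrightarrow> norm (G' x) \<le> S"
  shows "norm (h *\<^sub>R G x - integral {0..h} G) \<le> h * (h * S)"
proof -
  have S: "S \<ge> 0"
    using bound[OF x] norm_ge_zero order_trans by blast
  have cont: "continuous_on {0..h} G"
    using deriv by (rule continuous_on_vector_derivative)
  have mv: "norm (G x - G y) \<le> h * S" if y: "y \<in> {0..h}" for y
  proof -
    have "norm (G x - G y) \<le> S * norm (x - y)"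
    proof (rule differentiable_bound[of "{0..h}" G "\<lambda>x u. u *\<^sub>R G' x"])
      show "(G has_derivative (\<lambda>u. u *\<^sub>R G' z)) (at z within {0..h})" if "z \<in> {0..h}" for z
        using deriv[OF that] by (simp add: has_vector_derivative_def)
      show "onorm (\<lambda>u. u *\<^sub>R G' z) \<le> S" if "z \<in> {0..h}" for z
        using bound[OF that] by (intro onorm_le) (auto simp: mult.commute[of S] intro: mult_left_mono)
    qed (use x y in auto)
    also have "\<dots> \<le> S * h"
      using x y S by (intro mult_left_mono) auto
    finally show ?thesis by (simp add: mult.commute)
  qed
  have "((\<lambda>y. G x - G y) has_integral (h *\<^sub>R G x - integral {0..h} G)) (cbox 0 h)"
    using has_integral_diff[OF has_integral_const_real[of "G x" 0 h]
        integrable_integral[OF integrable_continuous_real[OF cont]]] h by simp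
  then have "norm (h *\<^sub>R G x - integral {0..h} G) \<le> (h * S) * measure lborel (cbox 0 h)"
    by (rule has_integral_bound[rotated]) (use mv h S in auto)
  then show ?thesis using h by (simp add: mult_ac)
qed

lemma sum_integral_shift:
  fixes f :: "real \<Rightarrow> complex"
  assumes h: "0 \<le> h" and cont: "continuous_on UNIV f"
  shows "(\<Sum>k<m. integral {0..h} (\<lambda>x. f (A + real k * h + x))) = integral {A..A + real m * h} f"
proof (induction m)
  case (Suc m)
  have int: "f integrable_on {a..b}" for a b
    by (intro integrable_continuous_real continuous_on_subset[OF cont]) auto
  have "integral {0..h} (\<lambda>x. f (A + real m * h + x)) = integral {A + real m * h..A + real m * h + h} f"
    using integral_shift_Icc_real[of 0 h f "A + real m * h"] by (simp add: o_def add_ac)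
  then have "(\<Sum>k<Suc m. integral {0..h} (\<lambda>x. f (A + real k * h + x)))
      = integral {A..A + real m * h} f + integral {A + real m * h..A + real m * h + h} f"
    using Suc by simp
  also have "\<dots> = integral {A..A + real m * h + h} f"
    using h by (intro Henstock_Kurzweil_Integration.integral_combine int) auto
  finally show ?case by (simp add: algebra_simps)
qed auto

text \<open>
  The mean value over \<open>{0..h}\<close> of \<open>G x = h * (\<Sum>k<m. g (A + k h + x))\<close> is the integral of \<open>g\<close>, and a
  function on an interval of length \<open>h\<close> deviates from its mean by at most \<open>h * sup norm G'\<close>. Iterating
  this for \<open>G', G'', ...\<close>, whose means are boundary terms, and estimating the last derivative by
  Cauchy's inequality gives exponential accuracy.
\<close>
lemma trapezoid_error:
  fixes g :: "complex \<Rightarrow> complex" and b :: "real \<Rightarrow> real"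
  assumes hol: "g holomorphic_on UNIV" and h: "0 < h" and v: "0 < v" and n: "n \<ge> 1"
    and hn: "3 * real n * h \<le> v"
    and bound: "\<And>x w. A \<le> x \<Longrightarrow> x \<le> A + real m * h \<Longrightarrow> norm (w - of_real x) \<le> v \<Longrightarrow> norm (g w) \<le> b x"
    and E: "b A \<le> E" "b (A + real m * h) \<le> E"
    and M: "\<And>x. 0 \<le> x \<Longrightarrow> x \<le> h \<Longrightarrow> h * (\<Sum>k<m. b (A + real k * h + x)) \<le> M"
  shows "norm (of_real h * (\<Sum>k<m. g (of_real (A + real k * h)))
            - integral {A..A + real m * h} (\<lambda>x. g (of_real x))) \<le> 2 * E * v + exp (- real n) * M"
proof -
  define p where "p = (\<lambda>j. (deriv ^^ j) g)"
  \<comment> \<open>\<open>G j\<close> is the \<open>j\<close>-th derivative of the trapezoidal sum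
    as a function of the offset \<open>x\<close> of its nodes. \<open>G 0 0\<close> is the sum to be
    estimated, and the mean of \<open>G 0\<close> over \<open>{0..h}\<close> is the exact integral
    \<open>I\<close>.\<close>
  define G where "G = (\<lambda>j x. of_real h * (\<Sum>k<m. p j (of_real (A + real k * h + x))))"
  define I where "I = integral {A..A + real m * h} (\<lambda>x. g (of_real x))"
  have p_hol: "p j holomorphic_on UNIV" for j
    unfolding p_def by (intro holomorphic_higher_deriv hol) auto
  have p_deriv: "(p j has_field_derivative p (Suc j) z) (at z)" for j z
    using holomorphic_derivI[OF p_hol[of j] open_UNIV UNIV_I] by (simp add: p_def)
  have b_nonneg: "0 \<le> b x" if "A \<le> x" "x \<le> A + real m * h" for x
    using order_trans[OF norm_ge_zero bound[OF that, of "of_real x"]] v by simp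
  have E0: "E \<ge> 0"
    using b_nonneg[of A] E h by (smt (verit) mult_nonneg_nonneg of_nat_0_le_iff)
  have p_bound: "norm (p j (of_real x)) \<le> fact j * b x / v ^ j"
    if "A \<le> x" "x \<le> A + real m * h" for j x
    unfolding p_def
  proof (rule Cauchy_inequality)
    show "g holomorphic_on ball (complex_of_real x) v" "continuous_on (cball (complex_of_real x) v) g"
      using hol holomorphic_on_subset holomorphic_on_imp_continuous_on by blast+
    show "norm (g w) \<le> b x" if "norm (of_real x - w) = v" for w
      using bound[of x w] that \<open>A \<le> x\<close> \<open>x \<le> _\<close> by (simp add: norm_minus_commute)
  qed (use v in auto)
  have x_in: "A \<le> A + real k * h + x" "A + real k * h + x \<le> A + real m * h"
    if "k < m" "x \<in> {0..h}" for k x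
  proof -
    have "real k * h + h \<le> real m * h"
      using that h mult_right_mono[of "real (Suc k)" "real m" h] by (auto simp: algebra_simps)
    then show "A \<le> A + real k * h + x" "A + real k * h + x \<le> A + real m * h"
      using that h by auto
  qed
  have M0: "M \<ge> 0"
  proof -
    have "0 \<le> h * (\<Sum>k<m. b (A + real k * h + 0))"
      using h x_in[of _ 0] by (intro mult_nonneg_nonneg sum_nonneg b_nonneg) auto
    then show ?thesis using M[of 0] h by simp
  qed
  have G_deriv: "(G j has_vector_derivative G (Suc j) x) (at x within X)" for j x X
  proof -
    have "((\<lambda>x. p j (of_real (c + x))) has_vector_derivative p (Suc j) (of_real (c + x))) (at x within X)" for c
    proof -
      have "((\<lambda>w. p j (of_real c + w)) has_field_derivative p (Suc j) (of_real c + of_real x)) (at (of_real x))"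
        using DERIV_chain2[OF p_deriv[of j "of_real c + of_real x"]
          DERIV_add[OF DERIV_const[of "of_real c"] DERIV_ident]] by simp
      from has_vector_derivative_real_field[OF this] show ?thesis by simp
    qed
    then show ?thesis
      unfolding G_def by (intro has_vector_derivative_mult_right has_vector_derivative_sum)
  qed
  have G_cont: "continuous_on X (G j)" for j X
    by (rule continuous_on_vector_derivative, rule G_deriv)
  have G0_int: "integral {0..h} (G 0) = of_real h * I"
  proof -
    have cont: "continuous_on X (\<lambda>x. g (of_real x))" for X :: "real set"
      using hol by (intro continuous_on_compose2[OF holomorphic_on_imp_continuous_on[OF hol]] continuous_intros) auto
    have "integral {0..h} (G 0) = of_real h * (\<Sum>k<m. integral {0..h} (\<lambda>x. g (of_real (A + real k * h + x))))"
      unfolding G_def p_def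
      by (simp del: of_real_add of_real_mult, subst Henstock_Kurzweil_Integration.integral_sum)
         (auto simp del: of_real_add of_real_mult intro!: integrable_continuous_real
           continuous_on_compose2[OF cont[of UNIV]] continuous_intros)
    also have "\<dots> = of_real h * I"
      using sum_integral_shift[OF less_imp_le[OF h] cont, of A m] unfolding I_def by simp
    finally show ?thesis .
  qed
  \<comment> \<open>The increment of \<open>G j\<close> over one cell telescopes, so the means of
    the derivatives see \<open>g\<close> only at the two ends of the interval. This is why smallness
    of \<open>b\<close> is needed only there.\<close>
  have GS_int: "integral {0..h} (G (Suc j)) = of_real h * (p j (of_real (A + real m * h)) - p j (of_real A))" for j
  proof -
    have "(G (Suc j) has_integral (G j h - G j 0)) {0..h}"
      using h G_deriv by (intro fundamental_theorem_of_calculus) auto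
    moreover have "G j h - G j 0 = of_real h * (\<Sum>k<m. p j (of_real (A + real (Suc k) * h)) - p j (of_real (A + real k * h)))"
      by (simp add: G_def sum_subtractf algebra_simps)
    moreover have "\<dots> = of_real h * (p j (of_real (A + real m * h)) - p j (of_real A))"
      by (subst sum_lessThan_telescope) simp
    ultimately show ?thesis by (metis integral_unique)
  qed
  have hv: "0 \<le> h / v" "real n * (h / v) \<le> 1 / 3"
    using h v hn by (auto simp: field_simps)
  have mean: "h ^ Suc j * norm (p j (of_real (A + real m * h)) - p j (of_real A)) \<le> 2 * E * h"
    if "j < n" for j
  proof -
    have "norm (p j (of_real (A + real m * h)) - p j (of_real A)) \<le> fact j * b (A + real m * h) / v ^ j + fact j * b A / v ^ j"
      using h by (intro order_trans[OF norm_triangle_ineq4] add_mono p_bound) auto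
    also have "\<dots> \<le> fact j * E / v ^ j + fact j * E / v ^ j"
      using E v by (intro add_mono divide_right_mono mult_left_mono) auto
    finally have "h ^ Suc j * norm (p j (of_real (A + real m * h)) - p j (of_real A))
        \<le> h ^ Suc j * (2 * (fact j * E / v ^ j))"
      using h by (intro mult_left_mono) (simp_all add: mult_ac)
    also have "\<dots> = (2 * E * h) * (fact j * (h / v) ^ j)"
      by (simp add: power_divide)
    also have "\<dots> \<le> (2 * E * h) * 1"
    proof (intro mult_left_mono fact_times_power_le_one)
      have "real j * (h / v) \<le> real n * (h / v)"
        using that hv by (intro mult_right_mono) auto
      then show "real j * (h / v) \<le> 1" using hv by linarith
    qed (use hv E0 h in auto)
    finally show ?thesis by simp
  qed
  \<comment> \<open>Downward induction from \<open>j = n\<close>. With the weight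
    \<open>h ^ j\<close>, passing from \<open>Suc j\<close> to \<open>j\<close> does not amplify the
    bound but adds only the boundary term \<open>2 * E * h\<close>.\<close>
  have claim: "h ^ j * norm (G j x) \<le> real (n - j) * (2 * E * h) + exp (- real n) * M"
    if "1 \<le> j" "j \<le> n" "x \<in> {0..h}" for j x
    using that(2,1,3)
  proof (induction j arbitrary: x rule: inc_induct)
    case base
    have "norm (G n x) \<le> h * (\<Sum>k<m. fact n * b (A + real k * h + x) / v ^ n)"
      unfolding G_def norm_mult using h base x_in
      by (auto intro!: mult_left_mono order_trans[OF norm_sum] sum_mono p_bound simp del: of_real_add of_real_mult)
    also have "\<dots> = fact n / v ^ n * (h * (\<Sum>k<m. b (A + real k * h + x)))"
      by (simp add: sum_distrib_left sum_divide_distrib mult_ac)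
    also have "\<dots> \<le> fact n / v ^ n * M"
      using M[of x] v base by (intro mult_left_mono) auto
    finally have "h ^ n * norm (G n x) \<le> h ^ n * (fact n / v ^ n * M)"
      using h by (intro mult_left_mono) auto
    also have "\<dots> = fact n * (h / v) ^ n * M"
      by (simp add: power_divide)
    \<comment> \<open>Here the 3 in \<open>hn\<close> pays off:
      \<open>fact n * (3 * h / v) ^ n\<close> is still at most 1, and the factor
      \<open>(1 / 3) ^ n\<close> left over is at most \<open>exp (- n)\<close> because
      \<open>exp 1 \<le> 3\<close>.\<close>
    also have "fact n * (h / v) ^ n \<le> exp (- real n)"
    proof -
      have "fact n * (h / v) ^ n = (1/3) ^ n * (fact n * (3 * (h / v)) ^ n)"
        by (simp add: power_mult_distrib power_divide)
      also have "\<dots> \<le> (1/3) ^ n * 1"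
        using hv by (intro mult_left_mono fact_times_power_le_one) (use h v in \<open>auto simp: field_simps\<close>)
      also have "\<dots> \<le> exp (-1) ^ n"
        using exp_le by (auto intro!: power_mono simp: exp_minus field_simps)
      also have "\<dots> = exp (- real n)"
        by (simp flip: exp_of_nat_mult)
      finally show ?thesis .
    qed
    then have "fact n * (h / v) ^ n * M \<le> exp (- real n) * M"
      using M0 by (rule mult_right_mono)
    finally show ?case by simp
  next
    case (step j)
    define S where "S = (real (n - Suc j) * (2 * E * h) + exp (- real n) * M) / h ^ Suc j"
    have "norm (G (Suc j) y) \<le> S" if "y \<in> {0..h}" for y
      using step.IH[of y] that h by (simp add: S_def field_simps)
    then have *: "norm (h *\<^sub>R G j x - integral {0..h} (G j)) \<le> h * (h * S)"
      using G_deriv h step.prems by (intro norm_diff_integral_le_deriv) auto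
    obtain i where i: "j = Suc i" using step.prems by (cases j) auto
    have "norm (integral {0..h} (G j)) = h * norm (p i (of_real (A + real m * h)) - p i (of_real A))"
      unfolding i GS_int norm_mult using h by simp
    with * have "h * norm (G j x) \<le> h * (h * S + norm (p i (of_real (A + real m * h)) - p i (of_real A)))"
      using norm_triangle_sub[of "h *\<^sub>R G j x" "integral {0..h} (G j)"] h by (simp add: algebra_simps)
    then have "norm (G j x) \<le> h * S + norm (p i (of_real (A + real m * h)) - p i (of_real A))"
      using h by simp
    then have "h ^ j * norm (G j x) \<le> h ^ j * (h * S + norm (p i (of_real (A + real m * h)) - p i (of_real A)))"
      using h by (intro mult_left_mono) auto
    also have "\<dots> \<le> h ^ Suc j * S + 2 * E * h"
      using mean[of i] step i by (simp add: algebra_simps)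
    also have "h ^ Suc j * S = real (n - Suc j) * (2 * E * h) + exp (- real n) * M"
      using h by (simp add: S_def)
    also have "real (n - Suc j) * (2 * E * h) + exp (- real n) * M + 2 * E * h
        = real (n - j) * (2 * E * h) + exp (- real n) * M"
      using step(2) by (simp add: of_nat_diff algebra_simps)
    finally show ?case .
  qed
  define S where "S = (real (n - 1) * (2 * E * h) + exp (- real n) * M) / h"
  have "norm (G (Suc 0) y) \<le> S" if "y \<in> {0..h}" for y
    using claim[of 1 y] that h n by (simp add: S_def field_simps)
  then have "norm (h *\<^sub>R G 0 0 - integral {0..h} (G 0)) \<le> h * (h * S)"
    using G_deriv h by (intro norm_diff_integral_le_deriv) auto
  then have "h * norm (G 0 0 - I) \<le> h * (h * S)"
    using h unfolding G0_int by (simp add: scaleR_conv_of_real norm_mult flip: right_diff_distrib)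
  then have "norm (G 0 0 - I) \<le> h * S"
    using h by simp
  also have "\<dots> = 2 * E * (real (n - 1) * h) + exp (- real n) * M"
    using h by (simp add: S_def)
  also have "\<dots> \<le> 2 * E * v + exp (- real n) * M"
  proof -
    have "real (n - 1) * h \<le> 3 * real n * h"
      using h by (intro mult_right_mono) auto
    then show ?thesis using hn E0 by (intro add_right_mono mult_left_mono) auto
  qed
  finally show ?thesis
    by (simp add: G_def I_def p_def)
qed

section \<open>Negative powers as sums of exponentials\<close>

text \<open>Comparison with the integral of \<open>1 / (1 + z\<^sup>2)\<close>. Within a cell of
  length at most 1 the denominator varies by a factor of at most 3, so each summand is at most 3
  increments of arctan, and these telescope. The bound is uniform in \<open>y\<close>,
  \<open>m\<close> and \<open>h\<close>.\<close>

lemma sum_inverse_square_le: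
  assumes h: "0 < h" "h \<le> 1"
  shows "h * (\<Sum>k<m. 1 / (1 + (y + real k * h)\<^sup>2)) \<le> 3 * pi"
proof -
  have step: "h * (1 / (1 + z\<^sup>2)) \<le> 3 * (arctan (z + h) - arctan z)" for z
  proof -
    obtain \<xi> where \<xi>: "z < \<xi>" "\<xi> < z + h" "arctan (z + h) - arctan z = (z + h - z) * inverse (1 + \<xi>\<^sup>2)"
      using MVT2[of z "z + h" arctan "\<lambda>x. inverse (1 + x\<^sup>2)"] DERIV_arctan h by auto
    have "\<xi>\<^sup>2 \<le> 2 * z\<^sup>2 + 2 * (\<xi> - z)\<^sup>2"
      using zero_le_power2[of "2 * z - \<xi>"] by (simp add: power2_eq_square algebra_simps)
    moreover have "(\<xi> - z)\<^sup>2 \<le> 1"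
      using \<xi> h by (intro power_le_one) auto
    ultimately have "1 + \<xi>\<^sup>2 \<le> 3 * (1 + z\<^sup>2)"
      by (smt (verit) zero_le_power2)
    then have "1 / (1 + z\<^sup>2) \<le> 3 * inverse (1 + \<xi>\<^sup>2)"
      by (simp add: field_simps add_pos_nonneg)
    then show ?thesis
      using mult_left_mono[of "1 / (1 + z\<^sup>2)" "3 * inverse (1 + \<xi>\<^sup>2)" h] \<xi>(3) h by simp
  qed
  have "h * (\<Sum>k<m. 1 / (1 + (y + real k * h)\<^sup>2))
      \<le> (\<Sum>k<m. 3 * (arctan (y + real (Suc k) * h) - arctan (y + real k * h)))"
    unfolding sum_distrib_left
  proof (rule sum_mono)
    show "h * (1 / (1 + (y + real k * h)\<^sup>2)) \<le> 3 * (arctan (y + real (Suc k) * h) - arctan (y + real k * h))" for k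
      using step[of "y + real k * h"] by (simp add: distrib_right add_ac)
  qed
  also have "\<dots> = 3 * (arctan (y + real m * h) - arctan y)"
    unfolding sum_distrib_left[symmetric] using sum_lessThan_telescope[of "\<lambda>k. arctan (y + real k * h)" m] by simp
  also have "\<dots> \<le> 3 * pi"
    using arctan_ubound[of "y + real m * h"] arctan_lbound[of y] by (simp del: arctan_ubound arctan_lbound)
  finally show ?thesis .
qed

text \<open>The inequality \<open>1 + x \<le> exp x\<close> at \<open>x = s - ln (p / c)\<close>,
  which measures the distance to the maximiser of the left side.\<close>

lemma linear_minus_exp_le:
  fixes p c s :: real
  assumes "p > 0" "c > 0"
  shows "p * s - c * exp s \<le> p * ln (p / c)"
proof -
  have "p * (1 + (s - ln (p / c))) \<le> p * exp (s - ln (p / c))"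
    using assms by (intro mult_left_mono exp_ge_add_one_self) auto
  also have "p * exp (s - ln (p / c)) = c * exp s"
    using assms by (simp add: exp_diff)
  finally show ?thesis using assms by (simp add: algebra_simps)
qed

text \<open>Even after multiplication by \<open>exp \<bar>s\<bar>\<close>, which dominates
  \<open>(1 + s\<^sup>2) / 2\<close>, the left side stays bounded: for \<open>s \<ge> 0\<close> the
  exponent \<open>\<beta>\<close> becomes \<open>\<beta> + 1\<close>, for \<open>s < 0\<close> it
  becomes \<open>\<beta> - 1 \<ge> 0\<close>. The quadratic decay makes Riemann sums of the left
  side bounded uniformly in the number of nodes.\<close>

lemma exp_linear_minus_exp_le:
  fixes \<beta> c s :: real
  assumes \<beta>: "\<beta> \<ge> 1" and c: "c > 0"
  shows "exp (\<beta> * s - c * exp s) \<le> 2 * (1 + exp ((\<beta> + 1) * ln ((\<beta> + 1) / c))) / (1 + s\<^sup>2)"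
proof -
  let ?K = "exp ((\<beta> + 1) * ln ((\<beta> + 1) / c))"
  have sq: "1 + s\<^sup>2 \<le> 2 * exp \<bar>s\<bar>"
    using exp_lower_Taylor_quadratic[of "\<bar>s\<bar>"] by simp
  have "exp (\<beta> * s - c * exp s) * exp \<bar>s\<bar> \<le> 1 + ?K"
  proof (cases "s \<ge> 0")
    case True
    have "exp (\<beta> * s - c * exp s) * exp \<bar>s\<bar> = exp ((\<beta> + 1) * s - c * exp s)"
      using True by (simp add: algebra_simps flip: exp_add)
    also have "\<dots> \<le> ?K" using linear_minus_exp_le[of "\<beta> + 1" c s] assms by simp
    finally show ?thesis by simp
  next
    case False
    have "exp (\<beta> * s - c * exp s) * exp \<bar>s\<bar> = exp ((\<beta> - 1) * s - c * exp s)"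
      using False by (simp add: algebra_simps flip: exp_add)
    also have "\<dots> \<le> exp 0"
      using False \<beta> c by (subst exp_le_cancel_iff) (smt (verit) exp_gt_zero mult_nonneg_nonpos mult_pos_pos)
    finally show ?thesis by (simp add: add_increasing2)
  qed
  then have "2 * (exp (\<beta> * s - c * exp s) * exp \<bar>s\<bar>) \<le> 2 * (1 + ?K)"
    by (rule mult_left_mono) simp
  moreover have "exp (\<beta> * s - c * exp s) * (1 + s\<^sup>2) \<le> 2 * (exp (\<beta> * s - c * exp s) * exp \<bar>s\<bar>)"
    using mult_left_mono[OF sq, of "exp (\<beta> * s - c * exp s)"] by simp
  ultimately have "exp (\<beta> * s - c * exp s) * (1 + s\<^sup>2) \<le> 2 * (1 + ?K)"
    by (rule order_trans[rotated])
  then show ?thesis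
    by (simp add: pos_le_divide_eq add_pos_nonneg)
qed

text \<open>Near 0 the integrand is at most 1, so the piece cut off there is at most
  \<open>X1\<close>. Beyond \<open>X2\<close> half of the exponential decay absorbs the power of
  \<open>x\<close>, and the other half is integrated.\<close>

lemma Gamma_integral_truncation:
  fixes \<beta> :: real
  assumes \<beta>: "\<beta> \<ge> 1" and X: "0 \<le> X1" "X1 \<le> 1" "1 \<le> X2"
  shows "\<bar>Gamma \<beta> - integral {X1..X2} (\<lambda>x. x powr (\<beta> - 1) / exp x)\<bar>
           \<le> X1 + 2 * exp (\<beta> * ln (2 * \<beta>)) * exp (- X2 / 2)"
proof -
  let ?g = "\<lambda>x. x powr (\<beta> - 1) / exp x :: real"
  let ?K = "exp (\<beta> * ln (2 * \<beta>))"
  have G: "(?g has_integral Gamma \<beta>) {0..}"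
    using Gamma_integral_real[of \<beta>] \<beta> by simp
  have int: "?g integrable_on {a..b}" if "0 \<le> a" for a b
    using has_integral_integrable[OF G] by (rule integrable_on_subinterval) (use that in auto)
  have "(?g has_integral (integral {0..X2} ?g)) {0..X2}"
    using int by blast
  then have "((\<lambda>x. if x \<in> {0..X2} then ?g x else 0) has_integral (integral {0..X2} ?g)) {0..}"
    by (subst has_integral_restrict) auto
  from has_integral_diff[OF G this]
  have d: "((\<lambda>x. ?g x - (if x \<in> {0..X2} then ?g x else 0)) has_integral (Gamma \<beta> - integral {0..X2} ?g)) {0..}" .
  have e: "((\<lambda>x. ?K * exp (- (1 / 2) * x)) has_integral ?K * (exp (- (1 / 2) * X2) / (1 / 2))) {X2..}"
    by (intro has_integral_mult_right has_integral_exp_minus_to_infinity) auto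
  then have e': "((\<lambda>x. if x \<in> {X2..} then ?K * exp (- (1 / 2) * x) else 0) has_integral ?K * (exp (- (1 / 2) * X2) / (1 / 2))) {0..}"
    using X by (subst has_integral_restrict) auto
  have tail: "?g x \<le> ?K * exp (- (1 / 2) * x)" if x: "1 \<le> x" for x
  proof -
    have "?g x \<le> x powr \<beta> / exp x"
      using x by (intro divide_right_mono powr_mono) auto
    also have "x powr \<beta> / exp x = exp (\<beta> * ln x - x)"
      using x by (simp add: powr_def exp_diff)
    also have "\<dots> = exp (\<beta> * ln x - (1 / 2) * exp (ln x)) * exp (- (1 / 2) * x)"
      using x by (simp flip: exp_add)
    also have "\<dots> \<le> ?K * exp (- (1 / 2) * x)"
      using linear_minus_exp_le[of \<beta> "1 / 2" "ln x"] \<beta> by (intro mult_right_mono) (auto simp: mult_ac)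
    finally show ?thesis .
  qed
  have "norm (integral {0..} (\<lambda>x. ?g x - (if x \<in> {0..X2} then ?g x else 0)))
      \<le> integral {0..} (\<lambda>x. if x \<in> {X2..} then ?K * exp (- (1 / 2) * x) else 0)"
  proof (rule Henstock_Kurzweil_Integration.integral_norm_bound_integral)
    show "norm (?g x - (if x \<in> {0..X2} then ?g x else 0)) \<le> (if x \<in> {X2..} then ?K * exp (- (1 / 2) * x) else 0)"
      if "x \<in> {0..}" for x
      using that tail[of x] X by auto
  qed (use d e' in blast)+
  then have right: "\<bar>Gamma \<beta> - integral {0..X2} ?g\<bar> \<le> 2 * ?K * exp (- X2 / 2)"
    unfolding integral_unique[OF d] integral_unique[OF e'] by simp
  have "norm (integral {0..X1} ?g) \<le> 1 * measure lborel (cbox 0 X1)"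
  proof (rule has_integral_bound)
    show "(?g has_integral integral {0..X1} ?g) (cbox 0 X1)"
      using int[of 0 X1] by (simp add: integrable_integral)
    fix x assume x: "x \<in> cbox 0 X1"
    then have "x powr (\<beta> - 1) \<le> 1"
      using X \<beta> by (intro powr_le1) auto
    moreover have "1 \<le> exp x" using x by simp
    ultimately have "x powr (\<beta> - 1) / exp x \<le> 1"
      unfolding pos_divide_le_eq[OF exp_gt_zero] by linarith
    then show "norm (?g x) \<le> 1" by simp
  qed simp
  then have "norm (integral {0..X1} ?g) \<le> X1"
    using X by simp
  moreover have "integral {0..X1} ?g + integral {X1..X2} ?g = integral {0..X2} ?g"
    using X int by (intro Henstock_Kurzweil_Integration.integral_combine) auto
  ultimately show ?thesis using right by auto
qed

text \<open>Substitution \<open>x = t * exp u\<close> in the truncated Gamma integral.\<close>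

lemma powr_minus_integral:
  fixes \<beta> t :: real
  assumes \<beta>: "\<beta> \<ge> 1" and t: "t > 0" and AB: "A \<le> B"
  shows "((\<lambda>u. exp (\<beta> * u - t * exp u)) has_integral
           t powr (- \<beta>) * integral {t * exp A..t * exp B} (\<lambda>x. x powr (\<beta> - 1) / exp x)) {A..B}"
proof -
  have "((\<lambda>u. (t * exp u) *\<^sub>R ((t * exp u) powr (\<beta> - 1) / exp (t * exp u))) has_integral
      integral {t * exp A..t * exp B} (\<lambda>x. x powr (\<beta> - 1) / exp x)) {A..B}"
  proof (rule has_integral_substitution[where c = "t * exp A" and d = "t * exp B"])
    have "0 < t * exp A" using t by simp
    then show "continuous_on {t * exp A..t * exp B} (\<lambda>x. x powr (\<beta> - 1) / exp x)"
      by (intro continuous_intros) auto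
    show "((\<lambda>u. t * exp u) has_field_derivative t * exp x) (at x within {A..B})" for x
      by (auto intro!: derivative_eq_intros)
  qed (use AB t in auto)
  from has_integral_mult_right[OF this, of "t powr (- \<beta>)"] show ?thesis
  proof (rule has_integral_eq[rotated])
    fix u
    have "t * exp u * (t * exp u) powr (\<beta> - 1) = (t * exp u) powr \<beta>"
      using t by (simp add: powr_diff)
    also have "\<dots> = t powr \<beta> * exp (\<beta> * u)"
      using t by (simp add: powr_mult exp_powr_real mult.commute)
    finally show "t powr (- \<beta>) * ((t * exp u) *\<^sub>R ((t * exp u) powr (\<beta> - 1) / exp (t * exp u)))
        = exp (\<beta> * u - t * exp u)"
      using t by (simp add: exp_diff powr_minus field_simps)
  qed
qed

text \<open>Trapezoidal rule for the Gamma integral in the variable \<open>u\<close>, with discs of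
  radius 1. A step of order \<open>1 / L\<close> on a range of length of order
  \<open>ln (T / \<delta>) + L\<close> gives the product in the bound for \<open>N\<close>. The
  error is relative to \<open>t powr (- \<beta>)\<close> because the shift
  \<open>s = u + ln t\<close> turns the integrand into this factor times a function of
  \<open>s\<close> alone.\<close>

lemma powr_minus_quadrature:
  fixes \<beta> :: real
  assumes \<beta>: "\<beta> \<ge> 1"
  obtains C K :: real where "C > 0" "K > 0"
    "\<And>L \<delta> T. 1 \<le> L \<Longrightarrow> 0 < \<delta> \<Longrightarrow> \<delta> \<le> T \<Longrightarrow>
       \<exists>N wt lam. N \<ge> (1::nat) \<and> real N \<le> C * L * (ln (T / \<delta>) + L) \<and>
         (\<forall>j. wt j > 0 \<and> lam j > 0) \<and>
         (\<forall>t. \<delta> \<le> t \<and> t \<le> T \<longrightarrow>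
            \<bar>(\<Sum>j\<in>{1..N}. wt j * exp (- lam j * t)) - t powr (- \<beta>)\<bar> \<le> K * exp (- L) * t powr (- \<beta>))"
proof -
  \<comment> \<open>On the unit disc around a real \<open>u\<close>, \<open>Re (exp w)\<close> is at
    least \<open>c * exp u\<close>: the real part of \<open>w\<close> is at least
    \<open>u - 1\<close>, and the cosine of its imaginary part is at least 1/2 because
    \<open>1 \<le> pi / 3\<close>.\<close>
  define c :: real where "c = exp (- 1) / 2"
  have c: "c > 0" "c < 1"
    using exp_less_mono[of "-1::real" 0] unfolding c_def exp_zero by (simp, linarith)
  define K2 where "K2 = (\<beta> + 1) * ln ((\<beta> + 1) / c)"
  have "1 < (\<beta> + 1) / c" using \<beta> c by (simp add: less_divide_eq)
  then have K2: "K2 > 0" using \<beta> by (auto simp: K2_def intro!: mult_pos_pos)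
  define K1 where "K1 = 2 * (1 + exp K2)"
  define K3 where "K3 = exp (\<beta> * ln (2 * \<beta>))"
  have \<Gamma>: "Gamma \<beta> > 0" using \<beta> by simp
  \<comment> \<open>The three summands come from the ends of the range, the Cauchy term of the
    trapezoidal rule and the truncation of the Gamma integral. The division normalises the
    weights.\<close>
  define K where "K = (2 * exp \<beta> + exp \<beta> * K1 * (3 * pi) + (1 + 2 * K3)) / Gamma \<beta>"
  have "K1 > 0" "K3 > 0" by (auto simp: K1_def K3_def add_pos_pos)
  then have K: "K > 0" using \<Gamma> unfolding K_def by (intro divide_pos_pos add_pos_pos mult_pos_pos) auto
  show thesis
  proof (rule that[of "13 + 6 * K2" K])
    fix L \<delta> T :: real
    assume L: "1 \<le> L" and \<delta>: "0 < \<delta>" and T: "\<delta> \<le> T"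
    have T0: "T > 0" using \<delta> T by simp
    define \<Lambda> where "\<Lambda> = ln (T / \<delta>)"
    have \<Lambda>: "\<Lambda> \<ge> 0" "\<Lambda> = ln T - ln \<delta>" using \<delta> T T0 by (auto simp: \<Lambda>_def ln_div)
    define n where "n = nat \<lceil>L\<rceil>"
    have n: "L \<le> real n" "real n \<le> 2 * L" "n \<ge> 1" using L unfolding n_def by linarith+
    define h where "h = 1 / (3 * real n)"
    have h: "0 < h" "h \<le> 1" "3 * real n * h \<le> 1" using n(3) by (auto simp: h_def field_simps)
    \<comment> \<open>The cutoffs serve all \<open>t\<close> in \<open>{\<delta>..T}\<close> at
      once: \<open>A + ln t \<le> - L\<close> for \<open>t \<le> T\<close>, and the length
      \<open>W\<close> ensures \<open>B + ln t \<ge> L + K2\<close> for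
      \<open>t \<ge> \<delta>\<close>.\<close>
    define A where "A = - ln T - L"
    define W where "W = \<Lambda> + 2 * L + K2"
    have W: "W > 0" using \<Lambda> L K2 by (simp add: W_def)
    define m where "m = nat \<lceil>W / h\<rceil>"
    have m: "W / h \<le> real m" "real m \<le> W / h + 1" "m \<ge> 1"
    proof -
      have "W / h > 0" using W h by simp
      then show "W / h \<le> real m" "real m \<le> W / h + 1" "m \<ge> 1"
        unfolding m_def by linarith+
    qed
    define B where "B = A + real m * h"
    have B: "L + K2 - ln \<delta> \<le> B"
      using m(1) h(1) \<Lambda> by (simp add: B_def A_def W_def field_simps)
    have AB: "A \<le> B" using h by (simp add: B_def)
    have m_le: "real m \<le> (13 + 6 * K2) * L * (\<Lambda> + L)"
    proof -
      have "W \<le> (2 + K2) * (\<Lambda> + L)"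
      proof -
        have "K2 * 1 \<le> K2 * (\<Lambda> + L)" using K2 \<Lambda>(1) L by (intro mult_left_mono) auto
        moreover have "\<Lambda> + 2 * L \<le> 2 * (\<Lambda> + L)" using \<Lambda>(1) by simp
        ultimately show ?thesis unfolding W_def distrib_right by linarith
      qed
      then have "3 * real n * W \<le> 6 * L * ((2 + K2) * (\<Lambda> + L))"
        by (rule mult_mono[rotated]) (use n W L in auto)
      moreover have "1 * 1 \<le> L * (\<Lambda> + L)" by (rule mult_mono) (use L \<Lambda>(1) in auto)
      moreover have "W / h = 3 * real n * W" by (simp add: h_def)
      ultimately show ?thesis using m(2) by (simp add: algebra_simps)
    qed
    define x where "x = (\<lambda>j::nat. A + (real j - 1) * h)"
    define wt where "wt = (\<lambda>j. h / Gamma \<beta> * exp (\<beta> * x j))"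
    define lam where "lam = (\<lambda>j. exp (x j))"
    have err: "\<bar>(\<Sum>j\<in>{1..m}. wt j * exp (- lam j * t)) - t powr (- \<beta>)\<bar> \<le> K * exp (- L) * t powr (- \<beta>)"
      if t\<delta>: "\<delta> \<le> t" and tT: "t \<le> T" for t
    proof -
      have t: "t > 0" using \<delta> t\<delta> by simp
      have t_powr: "t powr (- \<beta>) = exp (- \<beta> * ln t)" using t by (simp add: powr_def)
      define f where "f = (\<lambda>u. exp (\<beta> * u - t * exp u))"
      define g where "g = (\<lambda>w::complex. exp (of_real \<beta> * w - of_real t * exp w))"
      have g_real: "g (of_real u) = of_real (f u)" for u
        by (simp add: g_def f_def exp_of_real flip: of_real_mult of_real_diff)
      define e where "e = (\<lambda>s. exp (\<beta> * s - c * exp s))"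
      \<comment> \<open>The factor \<open>exp \<beta>\<close> pays for replacing \<open>Re w\<close>
        by its upper bound \<open>u + 1\<close>; the loss in the double exponential is contained in
        the \<open>c\<close> of \<open>e\<close>.\<close>
      define b where "b = (\<lambda>u. t powr (- \<beta>) * exp \<beta> * e (u + ln t))"
      have g_bound: "norm (g w) \<le> b u" if w: "norm (w - of_real u) \<le> 1" for u w
      proof -
        have Im: "\<bar>Im w\<bar> \<le> 1" and Re: "\<bar>Re w - u\<bar> \<le> 1"
          using abs_Im_le_cmod[of "w - of_real u"] abs_Re_le_cmod[of "w - of_real u"] w by auto
        have "cos (pi / 3) \<le> cos \<bar>Im w\<bar>"
          using Im pi_gt3 by (subst cos_mono_le_eq) auto
        then have cos: "1 / 2 \<le> cos (Im w)" by (simp add: cos_60)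
        have "exp (u - 1) * (1 / 2) \<le> exp (Re w) * cos (Im w)"
          using Re cos by (intro mult_mono) auto
        then have "t * (exp (u - 1) * (1 / 2)) \<le> t * (exp (Re w) * cos (Im w))"
          using t by (intro mult_left_mono) auto
        moreover have "t * (exp (u - 1) * (1 / 2)) = c * exp (u + ln t)"
        proof -
          have "exp (u - 1) = exp u * exp (- 1)" by (simp flip: exp_add)
          moreover have "exp (u + ln t) = exp u * t" using t by (simp add: exp_add)
          ultimately show ?thesis by (simp only: c_def) simp
        qed
        moreover have "\<beta> * Re w \<le> \<beta> * (u + 1)"
          using Re \<beta> by (intro mult_left_mono) auto
        ultimately have "\<beta> * Re w - t * (exp (Re w) * cos (Im w)) \<le> - \<beta> * ln t + \<beta> + (\<beta> * (u + ln t) - c * exp (u + ln t))"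
          by (simp add: algebra_simps)
        then have "exp (\<beta> * Re w - t * (exp (Re w) * cos (Im w))) \<le> exp (- \<beta> * ln t + \<beta> + (\<beta> * (u + ln t) - c * exp (u + ln t)))"
          by simp
        then show ?thesis
          unfolding b_def e_def t_powr exp_add by (simp add: g_def Re_exp)
      qed
      have left_end: "e (A + ln t) \<le> exp (- L)"
      proof -
        have le: "A + ln t \<le> - L" using tT t by (simp add: A_def)
        then have "\<beta> * (A + ln t) \<le> 1 * (A + ln t)"
          using \<beta> L by (intro mult_right_mono_neg) auto
        then have "\<beta> * (A + ln t) - c * exp (A + ln t) \<le> 1 * (A + ln t) - 0"
          by (rule diff_mono) (use c in simp)
        also have "\<dots> \<le> - L" using le by simp
        finally have "\<beta> * (A + ln t) - c * exp (A + ln t) \<le> - L" .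
        then show ?thesis by (simp add: e_def)
      qed
      have sB: "L + K2 \<le> B + ln t"
        using B ln_mono[OF t\<delta> \<delta>] by linarith
      \<comment> \<open>One spare power of \<open>exp s\<close> is borrowed: with
        \<open>\<beta> + 1\<close> in place of \<open>\<beta>\<close> the exponent is at most
        \<open>K2\<close>, and returning the power subtracts at least \<open>L + K2\<close>.\<close>
      have right_end: "e (B + ln t) \<le> exp (- L)"
      proof -
        have "\<beta> * (B + ln t) - c * exp (B + ln t) = ((\<beta> + 1) * (B + ln t) - c * exp (B + ln t)) - (B + ln t)"
          by (simp only: distrib_right mult_1_left)
        also have "\<dots> \<le> K2 - (L + K2)"
          using linear_minus_exp_le[of "\<beta> + 1" c "B + ln t"] \<beta> c sB
          unfolding K2_def by (intro diff_mono) auto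
        finally show ?thesis by (simp add: e_def)
      qed
      define P where "P = t powr (- \<beta>)"
      have P: "P > 0" using t by (simp add: P_def)
      define S where "S = h * (\<Sum>k<m. f (A + real k * h))"
      define J where "J = integral {A..B} f"
      have f_int: "(f has_integral J) {A..B}"
        unfolding J_def f_def by (intro integrable_integral integrable_continuous_real continuous_intros)
      have "norm (of_real h * (\<Sum>k<m. g (of_real (A + real k * h))) - integral {A..A + real m * h} (\<lambda>x. g (of_real x)))
          \<le> 2 * (P * exp \<beta> * exp (- L)) * 1 + exp (- real n) * (P * exp \<beta> * K1 * (3 * pi))"
      proof (rule trapezoid_error[where b = b])
        show "g holomorphic_on UNIV" unfolding g_def by (intro holomorphic_intros)
        show "b A \<le> P * exp \<beta> * exp (- L)" "b (A + real m * h) \<le> P * exp \<beta> * exp (- L)"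
          using left_end right_end P unfolding b_def B_def[symmetric] P_def[symmetric]
          by (auto intro!: mult_left_mono)
        show "h * (\<Sum>k<m. b (A + real k * h + y)) \<le> P * exp \<beta> * K1 * (3 * pi)" for y
        proof -
          have "h * (\<Sum>k<m. b (A + real k * h + y))
              \<le> h * (\<Sum>k<m. P * exp \<beta> * K1 * (1 / (1 + (A + y + ln t + real k * h)\<^sup>2)))"
          proof (intro mult_left_mono sum_mono)
            fix k
            have "e (A + y + ln t + real k * h) \<le> K1 / (1 + (A + y + ln t + real k * h)\<^sup>2)"
              unfolding e_def K1_def K2_def using \<beta> c by (intro exp_linear_minus_exp_le) auto
            then have "P * exp \<beta> * e (A + y + ln t + real k * h) \<le> P * exp \<beta> * (K1 / (1 + (A + y + ln t + real k * h)\<^sup>2))"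
              using P by (intro mult_left_mono) auto
            then show "b (A + real k * h + y) \<le> P * exp \<beta> * K1 * (1 / (1 + (A + y + ln t + real k * h)\<^sup>2))"
              by (simp add: b_def P_def add_ac)
          qed (use h in auto)
          also have "\<dots> = P * exp \<beta> * K1 * (h * (\<Sum>k<m. 1 / (1 + (A + y + ln t + real k * h)\<^sup>2)))"
            by (simp add: sum_distrib_left mult_ac)
          also have "\<dots> \<le> P * exp \<beta> * K1 * (3 * pi)"
            using sum_inverse_square_le[OF h(1,2)] P by (intro mult_left_mono) (auto simp: K1_def)
          finally show ?thesis .
        qed
      qed (use h n g_bound in auto)
      moreover have "of_real h * (\<Sum>k<m. g (of_real (A + real k * h))) = complex_of_real S"
        unfolding g_real S_def by simp
      moreover have "integral {A..A + real m * h} (\<lambda>x. g (of_real x)) = of_real J"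
        using has_integral_linear[OF f_int bounded_linear_of_real[where ?'a = complex]]
        unfolding g_real B_def[symmetric] by (simp add: o_def integral_unique)
      ultimately have "\<bar>S - J\<bar> \<le> 2 * (P * exp \<beta> * exp (- L)) + exp (- real n) * (P * exp \<beta> * K1 * (3 * pi))"
        by (simp flip: of_real_diff)
      also have "\<dots> \<le> 2 * (P * exp \<beta> * exp (- L)) + exp (- L) * (P * exp \<beta> * K1 * (3 * pi))"
        using n P by (intro add_left_mono mult_right_mono) (auto simp: K1_def)
      finally have SJ: "\<bar>S - J\<bar> \<le> P * exp (- L) * (2 * exp \<beta> + exp \<beta> * K1 * (3 * pi))"
        by (simp add: algebra_simps)
      define I where "I = integral {t * exp A..t * exp B} (\<lambda>x. x powr (\<beta> - 1) / exp x)"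
      have J: "J = P * I"
        using powr_minus_integral[OF \<beta> t AB] f_int has_integral_unique unfolding f_def P_def I_def by blast
      have X1: "t * exp A \<le> exp (- L)"
      proof -
        have "t * exp A \<le> T * exp A" using tT by (intro mult_right_mono) auto
        also have "\<dots> = exp (- L)" using T0 by (simp add: A_def exp_diff exp_minus field_simps)
        finally show ?thesis .
      qed
      \<comment> \<open>The tail of the Gamma integral decays like \<open>exp (- X2 / 2)\<close>, so
        an upper limit of \<open>2 * L\<close> is what yields \<open>exp (- L)\<close>.\<close>
      have X2: "2 * L \<le> t * exp B"
      proof -
        have "2 * L \<le> 1 + L + L\<^sup>2 / 2"
          using zero_le_power2[of "L - 1"] by (simp add: power2_eq_square algebra_simps)
        also have "\<dots> \<le> exp L" using L by (intro exp_lower_Taylor_quadratic) auto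
        also have "\<dots> \<le> exp (B + ln t)" using sB K2 by simp
        also have "\<dots> = t * exp B" using t by (simp add: exp_add)
        finally show ?thesis .
      qed
      have "\<bar>Gamma \<beta> - I\<bar> \<le> t * exp A + 2 * K3 * exp (- (t * exp B) / 2)"
        unfolding I_def K3_def
      proof (rule Gamma_integral_truncation[OF \<beta>])
        have "exp (- L) \<le> 1" using L by simp
        then show "t * exp A \<le> 1" using X1 by linarith
        show "1 \<le> t * exp B" using X2 L by linarith
      qed (use t in auto)
      also have "\<dots> \<le> exp (- L) + 2 * K3 * exp (- L)"
        using X1 X2 by (intro add_mono mult_left_mono) (auto simp: K3_def)
      finally have "P * \<bar>Gamma \<beta> - I\<bar> \<le> P * (exp (- L) + 2 * K3 * exp (- L))"
        using P by (intro mult_left_mono) auto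
      moreover have "\<bar>P * Gamma \<beta> - J\<bar> = P * \<bar>Gamma \<beta> - I\<bar>"
        using P unfolding J by (simp add: abs_mult flip: right_diff_distrib)
      ultimately have "\<bar>S - P * Gamma \<beta>\<bar>
          \<le> P * exp (- L) * (2 * exp \<beta> + exp \<beta> * K1 * (3 * pi)) + P * (exp (- L) + 2 * K3 * exp (- L))"
        using SJ by linarith
      also have "\<dots> = Gamma \<beta> * (K * exp (- L) * P)"
        using \<Gamma> by (simp add: K_def field_simps)
      finally have fin: "\<bar>S - P * Gamma \<beta>\<bar> \<le> Gamma \<beta> * (K * exp (- L) * P)" .
      have "(\<Sum>j\<in>{1..m}. wt j * exp (- lam j * t)) = S / Gamma \<beta>"
      proof -
        have "(\<Sum>j\<in>{1..m}. wt j * exp (- lam j * t)) = (\<Sum>k<m. wt (Suc k) * exp (- lam (Suc k) * t))"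
          by (rule sum.reindex_bij_witness[of _ Suc "\<lambda>j. j - 1"]) auto
        also have "\<dots> = (\<Sum>k<m. h / Gamma \<beta> * f (A + real k * h))"
        proof (rule sum.cong[OF refl])
          fix k
          have "x (Suc k) = A + real k * h" by (simp add: x_def)
          then show "wt (Suc k) * exp (- lam (Suc k) * t) = h / Gamma \<beta> * f (A + real k * h)"
            by (simp add: wt_def lam_def f_def exp_diff exp_minus divide_inverse mult_ac)
        qed
        also have "\<dots> = S / Gamma \<beta>" by (simp add: S_def sum_distrib_left sum_divide_distrib)
        finally show ?thesis .
      qed
      moreover have "S / Gamma \<beta> - P = (S - P * Gamma \<beta>) / Gamma \<beta>"
        using \<Gamma> by (simp add: field_simps)
      ultimately have "\<bar>(\<Sum>j\<in>{1..m}. wt j * exp (- lam j * t)) - P\<bar> = \<bar>S - P * Gamma \<beta>\<bar> / Gamma \<beta>"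
        using \<Gamma> by simp
      also have "\<dots> \<le> Gamma \<beta> * (K * exp (- L) * P) / Gamma \<beta>"
        using fin \<Gamma> by (intro divide_right_mono) auto
      also have "\<dots> = K * exp (- L) * P" using \<Gamma> by simp
      finally show ?thesis unfolding P_def .
    qed
    show "\<exists>N wt lam. N \<ge> (1::nat) \<and> real N \<le> (13 + 6 * K2) * L * (ln (T / \<delta>) + L) \<and>
         (\<forall>j. wt j > 0 \<and> lam j > 0) \<and>
         (\<forall>t. \<delta> \<le> t \<and> t \<le> T \<longrightarrow>
            \<bar>(\<Sum>j\<in>{1..N}. wt j * exp (- lam j * t)) - t powr (- \<beta>)\<bar> \<le> K * exp (- L) * t powr (- \<beta>))"
      using m(3) m_le err h \<Gamma>
      by (intro exI[of _ m] exI[of _ wt] exI[of _ lam]) (auto simp: wt_def lam_def \<Lambda>_def)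
  qed (use K K2 in auto)
qed

section \<open>The Gaussian profile\<close>

text \<open>This is the characteristic function of the standard normal distribution, rescaled by
  \<open>c = sqrt (2 * t)\<close> so that
  \<open>(c * y)\<^sup>2 / 2 = t * y\<^sup>2\<close>.\<close>

lemma gaussian_fourier_has_integral:
  assumes t: "t > 0"
  shows "((\<lambda>y. exp (- (of_real y)\<^sup>2 * of_real t - \<i> * of_real y * of_real r))
            has_integral complex_of_real (sqrt (pi / t) * exp (- r\<^sup>2 / (4 * t)))) (UNIV :: real set)"
proof -
  define c where "c = sqrt (2 * t)"
  have c: "c > 0" "c\<^sup>2 = 2 * t" using t by (auto simp: c_def)
  define f where "f = (\<lambda>x. std_normal_density x *\<^sub>R exp (\<i> * complex_of_real (- (r / c) * x)))"
  have "integrable lborel f"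
    unfolding f_def
    by (rule Bochner_Integration.integrable_bound[OF integrable_normal_density[of 1 0]])
       (auto simp: norm_mult)
  moreover have "integral\<^sup>L lborel f = complex_of_real (exp (- (r / c)\<^sup>2 / 2))"
  proof -
    have "integral\<^sup>L lborel f = char std_normal_distribution (- (r / c))"
      unfolding char_def f_def by (subst integral_density) auto
    then show ?thesis by (simp add: char_std_normal_distribution)
  qed
  ultimately have "has_bochner_integral lborel f (complex_of_real (exp (- (r / c)\<^sup>2 / 2)))"
    by (simp add: has_bochner_integral_iff)
  then have "has_bochner_integral lborel (\<lambda>x. f (0 + c * x)) (complex_of_real (exp (- (r / c)\<^sup>2 / 2)) /\<^sub>R \<bar>c\<bar>)"
    using c by (subst (asm) lborel_has_bochner_integral_real_affine_iff[of c _ _ 0]) auto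
  then have "((\<lambda>x. f (c * x)) has_integral (complex_of_real (exp (- (r / c)\<^sup>2 / 2)) /\<^sub>R c)) UNIV"
    using has_integral_integral_lborel[of "\<lambda>x. f (c * x)"] c
    by (auto simp: has_bochner_integral_iff)
  then have "((\<lambda>x. sqrt (2 * pi) *\<^sub>R f (c * x)) has_integral
      (sqrt (2 * pi) *\<^sub>R (complex_of_real (exp (- (r / c)\<^sup>2 / 2)) /\<^sub>R c))) UNIV"
    by (rule has_integral_cmul)
  moreover have "sqrt (2 * pi) *\<^sub>R f (c * x)
      = exp (- (of_real x)\<^sup>2 * of_real t - \<i> * of_real x * of_real r)" for x
  proof -
    have "sqrt (2 * pi) *\<^sub>R f (c * x) = of_real (exp (- (c * x)\<^sup>2 / 2)) * exp (\<i> * complex_of_real (- (r / c) * (c * x)))"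
      unfolding f_def std_normal_density_def by (simp add: scaleR_conv_of_real)
    also have "\<dots> = exp (of_real (- t * x\<^sup>2)) * exp (\<i> * complex_of_real (- r * x))"
      using c by (simp add: power_mult_distrib mult_ac flip: exp_of_real)
    also have "\<dots> = exp (- (of_real x)\<^sup>2 * of_real t - \<i> * of_real x * of_real r)"
      unfolding exp_add[symmetric] by (rule arg_cong[of _ _ exp]) (simp add: algebra_simps)
    finally show ?thesis .
  qed
  moreover have "sqrt (2 * pi) *\<^sub>R (complex_of_real (exp (- (r / c)\<^sup>2 / 2)) /\<^sub>R c)
      = complex_of_real (sqrt (pi / t) * exp (- r\<^sup>2 / (4 * t)))"
  proof -
    have "sqrt (2 * pi) / c = sqrt (pi / t)"
      unfolding c_def using t by (simp flip: real_sqrt_divide)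
    moreover have "(r / c)\<^sup>2 / 2 = r\<^sup>2 / (4 * t)"
      using c t by (simp add: power_divide)
    moreover have "sqrt (2 * pi) *\<^sub>R (complex_of_real z /\<^sub>R c) = complex_of_real (sqrt (2 * pi) / c * z)" for z
      by (simp add: scaleR_conv_of_real field_simps)
    ultimately show ?thesis by simp
  qed
  ultimately show ?thesis by simp
qed

text \<open>Outside the interval \<open>\<bar>y\<bar> \<ge> Y\<close>, so half of the Gaussian
  exponent gives the factor \<open>exp (- Y\<^sup>2 * t / 2)\<close>. The other half is integrated
  over the whole line by the same Fourier formula with frequency 0 and time
  \<open>t / 2\<close>.\<close>

lemma gaussian_fourier_truncation:
  assumes t: "t > 0" and Y: "0 \<le> Y" "Y1 \<le> - Y" "Y \<le> Y2"
  shows "norm (integral {Y1..Y2} (\<lambda>y. exp (- (of_real y)\<^sup>2 * of_real t - \<i> * of_real y * of_real r))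
            - complex_of_real (sqrt (pi / t) * exp (- r\<^sup>2 / (4 * t))))
           \<le> exp (- Y\<^sup>2 * t / 2) * sqrt (2 * pi / t)"
proof -
  let ?f = "\<lambda>r t y. exp (- (of_real y)\<^sup>2 * of_real t - \<i> * of_real y * of_real r) :: complex"
  define J where "J = integral {Y1..Y2} (?f r t)"
  have norm_f: "norm (?f r t y) = exp (- y\<^sup>2 * t)" for r t y
    by (simp add: norm_exp_eq_Re)
  have "?f r t integrable_on {Y1..Y2}"
    by (intro integrable_continuous_real continuous_intros)
  then have "((\<lambda>y. if y \<in> {Y1..Y2} then ?f r t y else 0) has_integral J) UNIV"
    unfolding J_def by (subst has_integral_restrict_UNIV) (rule integrable_integral)
  from has_integral_diff[OF this gaussian_fourier_has_integral[OF t, of r]]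
  have d: "((\<lambda>y. (if y \<in> {Y1..Y2} then ?f r t y else 0) - ?f r t y) has_integral
      (J - complex_of_real (sqrt (pi / t) * exp (- r\<^sup>2 / (4 * t))))) UNIV" .
  have "((\<lambda>y. Re (?f 0 (t / 2) y)) has_integral sqrt (2 * pi / t)) UNIV"
    using has_integral_Re[OF gaussian_fourier_has_integral[of "t / 2" 0]] t by (simp add: mult_ac)
  then have g: "((\<lambda>y. exp (- Y\<^sup>2 * t / 2) * exp (- y\<^sup>2 * t / 2)) has_integral exp (- Y\<^sup>2 * t / 2) * sqrt (2 * pi / t)) UNIV"
    by (intro has_integral_mult_right) (simp add: Re_exp)
  have le: "norm ((if y \<in> {Y1..Y2} then ?f r t y else 0) - ?f r t y) \<le> exp (- Y\<^sup>2 * t / 2) * exp (- y\<^sup>2 * t / 2)" for y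
  proof (cases "y \<in> {Y1..Y2}")
    case False
    then have "Y\<^sup>2 \<le> y\<^sup>2" using Y by (subst abs_le_square_iff[symmetric]) auto
    then have "Y\<^sup>2 * t \<le> y\<^sup>2 * t" using t by (intro mult_right_mono) auto
    with False show ?thesis by (simp add: norm_f flip: exp_add) 
  qed simp
  have "norm (integral UNIV (\<lambda>y. (if y \<in> {Y1..Y2} then ?f r t y else 0) - ?f r t y))
      \<le> integral UNIV (\<lambda>y. exp (- Y\<^sup>2 * t / 2) * exp (- y\<^sup>2 * t / 2))"
    using d g le by (intro Henstock_Kurzweil_Integration.integral_norm_bound_integral) blast+
  then show ?thesis
    unfolding integral_unique[OF d] integral_unique[OF g] J_def .
qed

section \<open>The hyperbolic contour: bounds, deformation and quadrature\<close>

lemma Re_cosh: "Re (cosh w) = cosh (Re w) * cos (Im w)"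
  and Im_cosh: "Im (cosh w) = sinh (Re w) * sin (Im w)"
  by (simp_all add: cosh_field_def sinh_field_def Re_exp Im_exp field_simps)

lemma norm_sinh_le_cosh: "norm (sinh (w :: complex)) \<le> cosh (Re w)"
proof -
  have "norm (sinh w) = norm (exp w - exp (- w)) / 2"
    by (simp add: sinh_field_def norm_divide)
  also have "\<dots> \<le> (norm (exp w) + norm (exp (- w))) / 2"
    by (intro divide_right_mono norm_triangle_ineq4) auto
  also have "\<dots> = cosh (Re w)"
    by (simp add: cosh_field_def)
  finally show ?thesis .
qed

text \<open>The pullback of \<open>exp (z\<^sup>2 t - z r) dz\<close> under
  \<open>z = a cosh w\<close>. The substitution \<open>s = z\<^sup>2\<close> has already removed
  \<open>1 / sqrt s\<close> from the inverse Laplace integral, so the integrand is entire.\<close>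

definition hyperbola_integrand :: "real \<Rightarrow> real \<Rightarrow> real \<Rightarrow> complex \<Rightarrow> complex" where
  "hyperbola_integrand a t r w =
     of_real a * sinh w * exp ((of_real a * cosh w)\<^sup>2 * of_real t - of_real a * cosh w * of_real r)"

text \<open>In this strip \<open>cos (Im w)\<close> lies between 0 and 1/2. Hence
  \<open>Re (cosh w) \<ge> 0\<close>, so the factor with \<open>r\<close> is at most 1, and
  \<open>Re ((cosh w)\<^sup>2) \<le> 1 - (cosh (Re w))\<^sup>2 / 2\<close>. Half of this decay is
  spent on the prefactor \<open>a * sinh w\<close>, which turns the 1/2 into 1/4.\<close>

lemma norm_hyperbola_integrand_le:
  assumes a: "a > 0" and t: "t > 0" and r: "r \<ge> 0" and w: "pi / 3 \<le> Im w" "Im w \<le> pi / 2"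
  shows "norm (hyperbola_integrand a t r w) \<le> exp (a\<^sup>2 * t * (1 - (cosh (Re w))\<^sup>2 / 4)) / sqrt t"
proof -
  define u where "u = Re w"
  define q where "q = a * sqrt t * cosh u"
  have cos: "0 \<le> cos (Im w)" "cos (Im w) \<le> 1 / 2"
  proof -
    show "0 \<le> cos (Im w)" using w by (intro cos_ge_zero) auto
    have "cos (Im w) \<le> cos (pi / 3)"
      using w by (subst cos_mono_le_eq) auto
    then show "cos (Im w) \<le> 1 / 2" by (simp add: cos_60)
  qed
  have cos2: "(cos (Im w))\<^sup>2 \<le> 1 / 4"
    using power_mono[OF cos(2,1), of 2] by (simp add: power2_eq_square)
  have "Re ((cosh w)\<^sup>2) = (cosh u)\<^sup>2 * (cos (Im w))\<^sup>2 - (sinh u)\<^sup>2 * (sin (Im w))\<^sup>2"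
    by (simp add: power2_eq_square Re_cosh Im_cosh u_def mult_ac)
  also have "\<dots> = (cosh u)\<^sup>2 * (2 * (cos (Im w))\<^sup>2 - 1) + 1 - (cos (Im w))\<^sup>2"
    by (simp add: sinh_square_eq sin_squared_eq algebra_simps)
  also have "\<dots> \<le> (cosh u)\<^sup>2 * (- 1 / 2) + 1 - 0"
    using cos2 by (intro add_mono diff_mono mult_left_mono) auto
  finally have Re_sq: "Re ((cosh w)\<^sup>2) \<le> 1 - (cosh u)\<^sup>2 / 2" by simp
  have "Re ((of_real a * cosh w)\<^sup>2 * of_real t - of_real a * cosh w * of_real r)
      = a\<^sup>2 * t * Re ((cosh w)\<^sup>2) - a * (cosh u * cos (Im w)) * r"
    by (simp add: power_mult_distrib Re_cosh u_def mult_ac flip: of_real_power)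
  also have "\<dots> \<le> a\<^sup>2 * t * (1 - (cosh u)\<^sup>2 / 2) - 0"
    using a t r cos Re_sq by (intro diff_mono mult_left_mono) auto
  also have "\<dots> = a\<^sup>2 * t - q\<^sup>2 / 2"
    using t by (simp add: q_def power_mult_distrib algebra_simps)
  finally have "norm (hyperbola_integrand a t r w) \<le> a * cosh u * exp (a\<^sup>2 * t - q\<^sup>2 / 2)"
    unfolding hyperbola_integrand_def using norm_sinh_le_cosh[of w] a
    by (auto simp: norm_mult u_def intro!: mult_mono)
  then have "sqrt t * norm (hyperbola_integrand a t r w) \<le> sqrt t * (a * cosh u * exp (a\<^sup>2 * t - q\<^sup>2 / 2))"
    using t by (intro mult_left_mono) auto
  also have "\<dots> = q * exp (a\<^sup>2 * t - q\<^sup>2 / 2)"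
    by (simp add: q_def)
  also have "\<dots> \<le> exp (q\<^sup>2 / 4) * exp (a\<^sup>2 * t - q\<^sup>2 / 2)"
  proof (intro mult_right_mono)
    have "q \<le> 1 + q\<^sup>2 / 4"
      using zero_le_power2[of "q / 2 - 1"] by (simp add: power2_eq_square algebra_simps)
    also have "\<dots> \<le> exp (q\<^sup>2 / 4)" by (rule exp_ge_add_one_self)
    finally show "q \<le> exp (q\<^sup>2 / 4)" .
  qed auto
  also have "\<dots> = exp (a\<^sup>2 * t * (1 - (cosh u)\<^sup>2 / 4))"
    using t by (simp add: q_def power_mult_distrib algebra_simps flip: exp_add)
  finally show ?thesis
    using t by (simp add: u_def field_simps)
qed

lemma holomorphic_hyperbola_integrand [holomorphic_intros]:
  "hyperbola_integrand a t r holomorphic_on A"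
  unfolding hyperbola_integrand_def cosh_field_def sinh_field_def by (intro holomorphic_intros) auto

text \<open>
  The hyperbola is deformed to the imaginary axis (\<open>Im w = pi / 2\<close>), where the integral is a
  truncated Gaussian Fourier integral. The end pieces of the deformation are controlled by the
  decay of the integrand.
\<close>
lemma hyperbola_integral:
  assumes a: "a > 0" and t: "t > 0" and r: "r \<ge> 0" and \<phi>: "pi / 3 \<le> \<phi>" "\<phi> \<le> pi / 2"
    and U: "0 \<le> U" "A \<le> - U" "U \<le> B"
  shows "norm (integral {A..B} (\<lambda>u. hyperbola_integrand a t r (of_real u + \<i> * of_real \<phi>))
            - \<i> * of_real (sqrt (pi / t) * exp (- r\<^sup>2 / (4 * t))))
           \<le> 5 * exp (a\<^sup>2 * t * (1 - (cosh U)\<^sup>2 / 4)) / sqrt t"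
proof -
  define Q where "Q = exp (a\<^sup>2 * t * (1 - (cosh U)\<^sup>2 / 4))"
  define F where "F = (\<lambda>\<zeta>::complex. exp (\<zeta>\<^sup>2 * of_real t - \<zeta> * of_real r))"
  \<comment> \<open>With a primitive of the entire function \<open>F\<close>, contour integrals
    become differences of end values, so deforming the contour only requires comparing
    \<open>H\<close> at the ends of the two contours.\<close>
  obtain P where P: "(P has_field_derivative F \<zeta>) (at \<zeta>)" for \<zeta>
    by (rule holomorphic_convex_primitive'[of UNIV F]) (auto simp: F_def intro!: holomorphic_intros)
  define H where "H = (\<lambda>w. P (of_real a * cosh w))"
  have H: "(H has_field_derivative hyperbola_integrand a t r w) (at w)" for w
  proof -
    have "((\<lambda>w. of_real a * cosh w) has_field_derivative of_real a * sinh w) (at w)"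
      by (auto intro!: derivative_eq_intros)
    from DERIV_chain2[OF P this] show ?thesis
      by (simp add: H_def F_def hyperbola_integrand_def mult_ac)
  qed
  have H_int: "((\<lambda>u. hyperbola_integrand a t r (of_real u + \<i> * of_real \<psi>)) has_integral
      (H (of_real B + \<i> * of_real \<psi>) - H (of_real A + \<i> * of_real \<psi>))) {A..B}" for \<psi>
  proof (rule fundamental_theorem_of_calculus)
    show "((\<lambda>u. H (of_real u + \<i> * of_real \<psi>)) has_vector_derivative
       hyperbola_integrand a t r (of_real u + \<i> * of_real \<psi>)) (at u within {A..B})" for u
    proof (rule has_vector_derivative_real_field)
      show "((\<lambda>w. H (w + \<i> * of_real \<psi>)) has_field_derivative
          hyperbola_integrand a t r (of_real u + \<i> * of_real \<psi>)) (at (of_real u))"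
        using DERIV_chain2[OF H DERIV_add[OF DERIV_ident DERIV_const]] by simp
    qed
  qed (use U in auto)
  have edge: "norm (H (of_real u + \<i> * of_real \<phi>) - H (of_real u + \<i> * of_real (pi / 2))) \<le> Q / sqrt t"
    if u: "U \<le> \<bar>u\<bar>" for u
  proof -
    let ?S = "closed_segment (of_real u + \<i> * of_real \<phi>) (of_real u + \<i> * of_real (pi / 2))"
    have "norm (H (of_real u + \<i> * of_real \<phi>) - H (of_real u + \<i> * of_real (pi / 2)))
       \<le> (Q / sqrt t) * norm ((of_real u + \<i> * of_real \<phi>) - (of_real u + \<i> * of_real (pi / 2)))"
    proof (rule field_differentiable_bound[of ?S H "hyperbola_integrand a t r"])
      show "norm (hyperbola_integrand a t r z) \<le> Q / sqrt t" if z: "z \<in> ?S" for z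
      proof -
        obtain s where s: "0 \<le> s" "s \<le> 1"
          and z_eq: "z = (1 - s) *\<^sub>R (of_real u + \<i> * of_real \<phi>) + s *\<^sub>R (of_real u + \<i> * of_real (pi / 2))"
          using z by (auto simp: closed_segment_def)
        have "Im z \<in> closed_segment \<phi> (pi / 2)"
          using s unfolding z_eq closed_segment_def by auto
        moreover have "Re z = u"
          unfolding z_eq by (simp add: algebra_simps)
        ultimately have z: "Re z = u" "pi / 3 \<le> Im z" "Im z \<le> pi / 2"
          using \<phi> by (auto simp: closed_segment_eq_real_ivl split: if_splits)
        have "cosh U \<le> cosh \<bar>u\<bar>"
          using U u by (subst cosh_real_nonneg_le_iff) auto
        then have "(cosh U)\<^sup>2 \<le> (cosh u)\<^sup>2"
          by (intro power_mono) auto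
        then have "exp (a\<^sup>2 * t * (1 - (cosh u)\<^sup>2 / 4)) \<le> Q"
          unfolding Q_def using t by (auto intro!: mult_left_mono)
        then show ?thesis
          using order_trans[OF norm_hyperbola_integrand_le[OF a t r z(2,3)] divide_right_mono] z(1) t
          by simp
      qed
    qed (auto intro: has_field_derivative_at_within H)
    also have "(of_real u + \<i> * of_real \<phi>) - (of_real u + \<i> * of_real (pi / 2)) = \<i> * of_real (\<phi> - pi / 2)"
      by (simp add: right_diff_distrib)
    also have "norm (\<i> * of_real (\<phi> - pi / 2)) = pi / 2 - \<phi>"
      using \<phi> unfolding norm_mult norm_of_real by simp
    also have "(Q / sqrt t) * (pi / 2 - \<phi>) \<le> (Q / sqrt t) * 1"
      using \<phi> t pi_less_4 by (intro mult_left_mono) (auto simp: Q_def)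
    finally show ?thesis by simp
  qed
  define Y1 Y2 Y where "Y1 = a * sinh A" and "Y2 = a * sinh B" and "Y = a * sinh U"
  have Y: "0 \<le> Y" "Y1 \<le> - Y" "Y \<le> Y2"
    using a U by (auto simp: Y_def Y1_def Y2_def simp flip: mult_minus_right sinh_minus)
  \<comment> \<open>On the line \<open>Im w = pi / 2\<close> the contour is the imaginary axis
    itself, parametrised by \<open>y = a * sinh u\<close>.\<close>
  have axis: "H (of_real u + \<i> * of_real (pi / 2)) = P (\<i> * of_real (a * sinh u))" for u
  proof -
    have "cosh (of_real u + \<i> * of_real (pi / 2)) = \<i> * of_real (sinh u)"
      by (rule complex_eqI) (auto simp: Re_cosh Im_cosh)
    then show ?thesis by (simp add: H_def mult_ac)
  qed
  have P_int: "((\<lambda>y. \<i> * exp (- (of_real y)\<^sup>2 * of_real t - \<i> * of_real y * of_real r)) has_integral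
      (P (\<i> * of_real Y2) - P (\<i> * of_real Y1))) {Y1..Y2}"
  proof (rule fundamental_theorem_of_calculus)
    show "((\<lambda>y. P (\<i> * of_real y)) has_vector_derivative
       \<i> * exp (- (of_real y)\<^sup>2 * of_real t - \<i> * of_real y * of_real r)) (at y within {Y1..Y2})" for y
    proof (rule has_vector_derivative_real_field)
      show "((\<lambda>w. P (\<i> * w)) has_field_derivative
          \<i> * exp (- (of_real y)\<^sup>2 * of_real t - \<i> * of_real y * of_real r)) (at (of_real y))"
        using DERIV_chain2[OF P DERIV_cmult[OF DERIV_ident, of \<i>], of "of_real y" UNIV]
        by (simp add: F_def power_mult_distrib mult_ac)
    qed
  qed (use Y in auto)
  have "P (\<i> * of_real Y2) - P (\<i> * of_real Y1)
      = \<i> * integral {Y1..Y2} (\<lambda>y. exp (- (of_real y)\<^sup>2 * of_real t - \<i> * of_real y * of_real r))"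
    using integral_unique[OF P_int] by simp
  then have "norm (P (\<i> * of_real Y2) - P (\<i> * of_real Y1) - \<i> * of_real (sqrt (pi / t) * exp (- r\<^sup>2 / (4 * t))))
      \<le> exp (- Y\<^sup>2 * t / 2) * sqrt (2 * pi / t)"
    using gaussian_fourier_truncation[OF t Y, of r]
    by (simp add: norm_mult flip: right_diff_distrib)
  also have "\<dots> \<le> Q * (3 / sqrt t)"
  proof (intro mult_mono)
    have "1 / 2 - (cosh U)\<^sup>2 / 2 \<le> 1 - (cosh U)\<^sup>2 / 4"
      using zero_le_power2[of "cosh U"] by linarith
    then have "a\<^sup>2 * t * (1 / 2 - (cosh U)\<^sup>2 / 2) \<le> a\<^sup>2 * t * (1 - (cosh U)\<^sup>2 / 4)"
      using t by (intro mult_left_mono) auto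
    moreover have "- Y\<^sup>2 * t / 2 = a\<^sup>2 * t * (1 / 2 - (cosh U)\<^sup>2 / 2)"
      unfolding Y_def power_mult_distrib sinh_square_eq by (simp add: right_diff_distrib left_diff_distrib diff_divide_distrib)
    ultimately show "exp (- Y\<^sup>2 * t / 2) \<le> Q"
      by (simp add: Q_def)
    have "sqrt (2 * pi) \<le> 3" using pi_less_4 by (intro real_le_lsqrt) auto
    then show "sqrt (2 * pi / t) \<le> 3 / sqrt t"
      using t by (auto simp: real_sqrt_divide intro!: divide_right_mono)
  qed (use t in \<open>auto simp: Q_def\<close>)
  also have "Q * (3 / sqrt t) = 3 * Q / sqrt t" by simp
  finally have main: "norm (P (\<i> * of_real Y2) - P (\<i> * of_real Y1)
      - \<i> * of_real (sqrt (pi / t) * exp (- r\<^sup>2 / (4 * t)))) \<le> 3 * Q / sqrt t" .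
  define dB dA where
    "dB = H (of_real B + \<i> * of_real \<phi>) - H (of_real B + \<i> * of_real (pi / 2))" and
    "dA = H (of_real A + \<i> * of_real \<phi>) - H (of_real A + \<i> * of_real (pi / 2))"
  have "integral {A..B} (\<lambda>u. hyperbola_integrand a t r (of_real u + \<i> * of_real \<phi>))
      - \<i> * of_real (sqrt (pi / t) * exp (- r\<^sup>2 / (4 * t)))
    = (dB - dA) + (P (\<i> * of_real Y2) - P (\<i> * of_real Y1) - \<i> * of_real (sqrt (pi / t) * exp (- r\<^sup>2 / (4 * t))))"
  proof -
    have "x - y - c = ((x - p) - (y - q)) + (p - q - c)" for x y c p q :: complex
      by simp
    then show ?thesis
      unfolding integral_unique[OF H_int] dA_def dB_def axis Y1_def Y2_def .
  qed
  \<comment> \<open>The constant 5 is made up of one for each end segment, whose length is below 1,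
    and 3 for the Gaussian truncation, where \<open>sqrt (2 * pi) \<le> 3\<close>.\<close>
  also have "norm \<dots> \<le> (norm dB + norm dA) + 3 * Q / sqrt t"
    by (intro order_trans[OF norm_triangle_ineq] add_mono norm_triangle_ineq4 main)
  also have "\<dots> \<le> (Q / sqrt t + Q / sqrt t) + 3 * Q / sqrt t"
    using edge[of B] edge[of A] U by (intro add_mono) (auto simp: dA_def dB_def)
  also have "\<dots> = 5 * Q / sqrt t" by (simp add: field_simps)
  finally show ?thesis unfolding Q_def .
qed

text \<open>The choice \<open>a\<^sup>2 = L / T\<close> keeps the growth
  \<open>exp (a\<^sup>2 * t)\<close> below \<open>exp L\<close> for \<open>t \<le> T\<close>, while
  \<open>a\<^sup>2 * t \<ge> L * \<delta> / T\<close> for \<open>t \<ge> \<delta>\<close>. The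
  latter is only exponentially small in \<open>\<Lambda>\<close>, so the growth of
  \<open>(cosh u)\<^sup>2\<close> overcomes it once \<open>\<bar>u\<bar> \<ge> \<Lambda>\<close>.
  The number of nodes is the range, of order \<open>\<Lambda>\<close>, divided by a step of order
  \<open>1 / (L + ln \<Lambda>)\<close>.\<close>

lemma heat_profile_approx:
  fixes L \<delta> T :: real
  assumes L: "L \<ge> 4" and \<delta>: "\<delta> > 0" and T: "T \<ge> 1000 * \<delta>"
  defines "\<Lambda> \<equiv> ln (T / \<delta>)"
  obtains N :: nat and w s :: "int \<Rightarrow> complex" where
    "N \<ge> 1" "real N \<le> 200 * \<Lambda> * (L + ln \<Lambda>)"
    "\<And>k. \<not> (Im (s k) = 0 \<and> Re (s k) \<le> 0)"
    "\<And>r t. 0 \<le> r \<Longrightarrow> \<delta> \<le> t \<Longrightarrow> t \<le> T \<Longrightarrow>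
       cmod ((\<Sum>k\<in>{- int N..int N}. w k * exp (s k * of_real t) * exp (- csqrt (s k) * of_real r))
             - of_real (exp (- r\<^sup>2 / (4 * t)) / sqrt t)) \<le> exp (- L) / sqrt t"
proof -
  define X where "X = T / \<delta>"
  have X: "X \<ge> 1000" using \<delta> T by (simp add: X_def field_simps)
  have exp\<Lambda>: "exp \<Lambda> = X" using X by (simp add: \<Lambda>_def X_def[symmetric])
  have T0: "T > 0" using \<delta> T by linarith
  have \<Lambda>: "\<Lambda> \<ge> 6"
  proof -
    have "exp (6::real) = exp 1 ^ 6" by (simp flip: exp_of_nat_mult)
    also have "\<dots> \<le> 3 ^ 6" using exp_le by (intro power_mono) auto
    also have "\<dots> \<le> exp \<Lambda>" using X exp\<Lambda> by simp
    finally show ?thesis by simp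
  qed
  have ln\<Lambda>: "ln \<Lambda> \<ge> 0" using \<Lambda> by simp
  \<comment> \<open>The Cauchy term is \<open>exp (- n)\<close> times \<open>exp L\<close> times a
    range of length at most \<open>3 * \<Lambda>\<close>. This \<open>n\<close> brings it down to
    the order of \<open>exp (- 2 * L)\<close>.\<close>
  define n where "n = nat \<lceil>3 * L + ln \<Lambda>\<rceil>"
  have n: "3 * L + ln \<Lambda> \<le> real n" "real n \<le> 3 * L + ln \<Lambda> + 1" "n \<ge> 1"
    using L ln\<Lambda> unfolding n_def by linarith+
  \<comment> \<open>Discs of radius \<open>pi / 24\<close> around points with imaginary part
    \<open>3 * pi / 8\<close> stay between \<open>pi / 3\<close> and \<open>5 * pi / 12\<close>,
    inside the strip where the integrand is controlled. The extra 1 in \<open>N\<close> leaves room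
    for these discs at the ends.\<close>
  define v h N a \<phi> where "v = pi / 24" and "h = v / (3 * real n)" and "N = nat \<lceil>(\<Lambda> + 1) / h\<rceil>"
    and "a = sqrt (L / T)" and "\<phi> = 3 * pi / 8"
  have v: "0 < v" "v \<le> 1 / 6" using pi_less_4 by (auto simp: v_def)
  have h: "0 < h" "h \<le> 1 / 6" "3 * real n * h \<le> v"
  proof -
    show "0 < h" "3 * real n * h \<le> v" using v n(3) by (auto simp: h_def)
    have "h \<le> v / 1" unfolding h_def using v n(3) by (intro divide_left_mono) auto
    then show "h \<le> 1 / 6" using v by simp
  qed
  have N: "(\<Lambda> + 1) / h \<le> real N" "real N \<le> (\<Lambda> + 1) / h + 1" "N \<ge> 1"
  proof -
    have "(\<Lambda> + 1) / h > 0" using \<Lambda> h by simp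
    then show "(\<Lambda> + 1) / h \<le> real N" "real N \<le> (\<Lambda> + 1) / h + 1" "N \<ge> 1"
      unfolding N_def by linarith+
  qed
  have Nh: "\<Lambda> + 1 \<le> real N * h" "real N * h \<le> \<Lambda> + 1 + h"
    using N(1,2) h(1) by (simp_all add: field_simps)
  have N_le: "real N \<le> 200 * \<Lambda> * (L + ln \<Lambda>)"
  proof -
    have "1 / h = 72 * real n / pi" by (simp add: h_def v_def)
    also have "\<dots> \<le> 72 * real n / 3" using pi_gt3 by (intro divide_left_mono) auto
    also have "\<dots> \<le> 24 * (4 * (L + ln \<Lambda>))" using n(2) L ln\<Lambda> by simp
    finally have "(\<Lambda> + 1) * (1 / h) \<le> (2 * \<Lambda>) * (24 * (4 * (L + ln \<Lambda>)))"
      using \<Lambda> h L ln\<Lambda> by (intro mult_mono) auto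
    moreover have "1 * 1 \<le> \<Lambda> * (L + ln \<Lambda>)"
    proof (rule mult_mono)
      show "1 \<le> L + ln \<Lambda>" using L ln\<Lambda> by linarith
    qed (use \<Lambda> in auto)
    ultimately show ?thesis using N(2) by (simp add: algebra_simps)
  qed
  have a: "a > 0" "a\<^sup>2 = L / T" using L T0 by (auto simp: a_def)
  define z where "z = (\<lambda>k::int. of_real a * cosh (of_real (of_int k * h) + \<i> * of_real \<phi>))"
  \<comment> \<open>The denominator cancels the factor \<open>\<i> * sqrt pi\<close> that the
    contour integral carries in front of the profile.\<close>
  define w where "w = (\<lambda>k::int. of_real h * of_real a * sinh (of_real (of_int k * h) + \<i> * of_real \<phi>) / (\<i> * of_real (sqrt pi)))"
  have Re_z: "Re (z k) > 0" for k
  proof -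
    have "cos \<phi> > 0" by (intro cos_gt_zero_pi) (auto simp: \<phi>_def)
    then show ?thesis using a by (simp add: z_def Re_cosh)
  qed
  \<comment> \<open>Since \<open>Re (z k) > 0\<close>, the principal root of
    \<open>s k = (z k)\<^sup>2\<close> is \<open>z k\<close>, so the quadrature has the required
    form.\<close>
  have csqrt_z: "csqrt ((z k)\<^sup>2) = z k" for k
    using Re_z[of k] by (intro csqrt_square) auto
  have s: "\<not> (Im ((z k)\<^sup>2) = 0 \<and> Re ((z k)\<^sup>2) \<le> 0)" for k
  proof
    assume *: "Im ((z k)\<^sup>2) = 0 \<and> Re ((z k)\<^sup>2) \<le> 0"
    then have "Im (z k) = 0" using Re_z[of k] by (simp add: power2_eq_square)
    with * show False using Re_z[of k] by (simp add: power2_eq_square mult_le_0_iff)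
  qed
  show thesis
  proof (rule that[of N "\<lambda>k. (z k)\<^sup>2" w])
    fix r t :: real
    assume r: "0 \<le> r" and t\<delta>: "\<delta> \<le> t" and tT: "t \<le> T"
    have t: "t > 0" using t\<delta> \<delta> by simp
    have a2t: "a\<^sup>2 * t \<le> L" "L / X \<le> a\<^sup>2 * t"
      using L T0 tT t\<delta> \<delta> by (simp_all add: a X_def field_simps mult_left_mono)
    \<comment> \<open>As \<open>exp \<Lambda> = X\<close>, the square of cosh is at least
      \<open>X\<^sup>2 / 4\<close>. One power of \<open>X\<close> compensates the lower bound
      \<open>L / X\<close> for \<open>a\<^sup>2 * t\<close>; the other, being at least 1000, absorbs
      the constants.\<close>
    have decay: "a\<^sup>2 * t * (1 - (cosh u)\<^sup>2 / 4) \<le> - 2 * L" if u: "\<Lambda> \<le> \<bar>u\<bar>" for u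
    proof -
      have "X / 2 \<le> exp \<bar>u\<bar> / 2" using u by (simp flip: exp\<Lambda>)
      also have "\<dots> \<le> cosh \<bar>u\<bar>" by (simp add: cosh_field_def)
      finally have "(X / 2)\<^sup>2 \<le> (cosh u)\<^sup>2" using X by (intro power_mono) auto
      moreover have "1000 * X \<le> X * X" using X by (intro mult_right_mono) auto
      moreover have "(X / 2)\<^sup>2 = X * X / 4" by (simp add: power2_eq_square)
      ultimately have "1 - (cosh u)\<^sup>2 / 4 \<le> - 2 * X"
        using X by linarith
      then have "a\<^sup>2 * t * (1 - (cosh u)\<^sup>2 / 4) \<le> a\<^sup>2 * t * (- 2 * X)"
        using t by (intro mult_left_mono) auto
      also have "\<dots> \<le> (L / X) * (- 2 * X)"
        using a2t X by (intro mult_right_mono_neg) auto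
      also have "\<dots> = - 2 * L" using X by simp
      finally show ?thesis .
    qed
    define g where "g = (\<lambda>\<zeta>. hyperbola_integrand a t r (\<zeta> + \<i> * of_real \<phi>))"
    define E where "E = exp (- 2 * L) / sqrt t"
    \<comment> \<open>Between the ends the crude bound \<open>exp L / sqrt t\<close> suffices,
      because there the trapezoidal rule supplies the factor \<open>exp (- n)\<close>.\<close>
    define b where "b = (\<lambda>x. if real N * h \<le> \<bar>x\<bar> then E else exp L / sqrt t)"
    have E_le: "E \<le> exp L / sqrt t" unfolding E_def using t L by (intro divide_right_mono) auto
    have g_bound: "norm (g \<zeta>) \<le> b x" if \<zeta>: "norm (\<zeta> - of_real x) \<le> v" for x \<zeta>
    proof -
      have Im: "\<bar>Im \<zeta>\<bar> \<le> v" and Re: "\<bar>Re \<zeta> - x\<bar> \<le> v"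
        using abs_Im_le_cmod[of "\<zeta> - of_real x"] abs_Re_le_cmod[of "\<zeta> - of_real x"] \<zeta> by auto
      have "norm (g \<zeta>) \<le> exp (a\<^sup>2 * t * (1 - (cosh (Re (\<zeta> + \<i> * of_real \<phi>)))\<^sup>2 / 4)) / sqrt t"
        unfolding g_def using a t r Im by (intro norm_hyperbola_integrand_le) (auto simp: \<phi>_def v_def)
      also have "\<dots> \<le> b x"
      proof (cases "real N * h \<le> \<bar>x\<bar>")
        case True
        then have "\<Lambda> \<le> \<bar>Re \<zeta>\<bar>" using Nh Re v by linarith
        from decay[OF this] show ?thesis
          using True t by (simp add: b_def E_def divide_right_mono)
      next
        case False
        have "a\<^sup>2 * t * (1 - (cosh (Re \<zeta>))\<^sup>2 / 4) \<le> a\<^sup>2 * t * 1"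
          using t by (intro mult_left_mono) auto
        with False a2t show ?thesis
          using t by (simp add: b_def divide_right_mono)
      qed
      finally show ?thesis .
    qed
    define A where "A = - (real N * h)"
    \<comment> \<open>The rule samples the left ends of \<open>m\<close> cells, so the
      \<open>2 * N + 1\<close> nodes from \<open>- N * h\<close> to \<open>N * h\<close> belong to
      an interval that ends at \<open>(N + 1) * h\<close>, where \<open>b\<close> is still
      small.\<close>
    define m where "m = 2 * N + 1"
    have B: "A + real m * h = real (N + 1) * h" by (simp add: A_def m_def algebra_simps)
    define S where "S = of_real h * (\<Sum>k<m. g (of_real (A + real k * h)))"
    define J where "J = integral {A..A + real m * h} (\<lambda>x. g (of_real x))"
    define G where "G = \<i> * of_real (sqrt (pi / t) * exp (- r\<^sup>2 / (4 * t)))"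
    have trapezoid: "norm (S - J) \<le> 2 * E * v + exp (- real n) * (h * (real m * (exp L / sqrt t)))"
      unfolding S_def J_def
    proof (rule trapezoid_error[where b = b])
      show "g holomorphic_on UNIV"
        unfolding g_def
        by (rule holomorphic_on_compose[unfolded o_def, of "\<lambda>\<zeta>. \<zeta> + \<i> * of_real \<phi>" UNIV])
           (intro holomorphic_intros)+
      have "real N * h \<le> real (N + 1) * h" using h by (intro mult_right_mono) auto
      then show "b (A + real m * h) \<le> E" unfolding B by (auto simp: b_def)
      show "b A \<le> E" by (auto simp: b_def A_def)
      show "h * (\<Sum>k<m. b (A + real k * h + x)) \<le> h * (real m * (exp L / sqrt t))" for x
      proof -
        have "(\<Sum>k<m. b (A + real k * h + x)) \<le> (\<Sum>k<m. exp L / sqrt t)"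
          using E_le by (intro sum_mono) (auto simp: b_def)
        then show ?thesis using h by (intro mult_left_mono) auto
      qed
    qed (use h v n g_bound in auto)
    also have "\<dots> \<le> E + 3 * E"
    proof (rule add_mono)
      have "E * (2 * v) \<le> E * 1" using v t by (intro mult_left_mono) (auto simp: E_def)
      then show "2 * E * v \<le> E" by simp
      have "h * real m \<le> 3 * \<Lambda>"
        using Nh h \<Lambda> by (simp add: m_def algebra_simps)
      moreover have "exp (- real n) \<le> exp (- (3 * L)) / \<Lambda>"
      proof -
        have "exp (- real n) \<le> exp (- (3 * L) - ln \<Lambda>)" using n by simp
        also have "\<dots> = exp (- (3 * L)) / \<Lambda>" using \<Lambda> by (simp add: exp_diff)
        finally show ?thesis .
      qed
      ultimately have "exp (- real n) * (h * real m) \<le> exp (- (3 * L)) / \<Lambda> * (3 * \<Lambda>)"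
        by - (rule mult_mono, assumption+, use h \<Lambda> in auto)
      also have "\<dots> = 3 * exp (- (3 * L))" using \<Lambda> by simp
      finally have "exp (- real n) * (h * real m) * (exp L / sqrt t) \<le> 3 * exp (- (3 * L)) * (exp L / sqrt t)"
        using t by (intro mult_right_mono) auto
      also have "\<dots> = 3 * (exp (- (3 * L) + L) / sqrt t)"
        unfolding exp_add by simp
      also have "\<dots> = 3 * E" by (simp add: E_def)
      finally show "exp (- real n) * (h * (real m * (exp L / sqrt t))) \<le> 3 * E"
        by (simp only: mult.assoc)
    qed
    finally have SJ: "norm (S - J) \<le> 4 * E" by simp
    have "norm (J - G) \<le> 5 * exp (a\<^sup>2 * t * (1 - (cosh \<Lambda>)\<^sup>2 / 4)) / sqrt t"
      unfolding J_def G_def g_def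
    proof (rule hyperbola_integral)
      show "A \<le> - \<Lambda>" using Nh by (simp add: A_def)
      show "\<Lambda> \<le> A + real m * h" unfolding B using Nh h by (simp add: algebra_simps)
    qed (use a t r \<Lambda> in \<open>auto simp: \<phi>_def\<close>)
    also have "\<dots> \<le> 5 * exp (- 2 * L) / sqrt t"
      using decay[of \<Lambda>] t by (intro divide_right_mono) auto
    also have "\<dots> = 5 * E" by (simp add: E_def)
    finally have "norm (S - G) \<le> 9 * E"
      using SJ norm_triangle_ineq[of "S - J" "J - G"] by simp
    moreover have "S - G = \<i> * of_real (sqrt pi) * ((\<Sum>k\<in>{- int N..int N}. w k * exp ((z k)\<^sup>2 * of_real t) * exp (- csqrt ((z k)\<^sup>2) * of_real r))
             - of_real (exp (- r\<^sup>2 / (4 * t)) / sqrt t))"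
    proof -
      have "(\<Sum>k<m. g (of_real (A + real k * h))) = (\<Sum>k\<in>{- int N..int N}. g (of_real (of_int k * h)))"
        by (rule sum.reindex_bij_witness[of _ "\<lambda>k. nat (k + int N)" "\<lambda>k. int k - int N"])
           (auto simp: m_def A_def algebra_simps)
      moreover have "of_real h * g (of_real (of_int k * h))
          = \<i> * of_real (sqrt pi) * (w k * exp ((z k)\<^sup>2 * of_real t) * exp (- csqrt ((z k)\<^sup>2) * of_real r))" for k
      proof -
        have "of_real h * g (of_real (of_int k * h))
            = (\<i> * of_real (sqrt pi) * w k) * exp ((z k)\<^sup>2 * of_real t - z k * of_real r)"
          by (simp add: g_def hyperbola_integrand_def w_def z_def)
        also have "exp ((z k)\<^sup>2 * of_real t - z k * of_real r) = exp ((z k)\<^sup>2 * of_real t) * exp (- z k * of_real r)"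
          by (simp flip: exp_add)
        finally show ?thesis unfolding csqrt_z by (simp only: mult.assoc)
      qed
      ultimately have "S = \<i> * of_real (sqrt pi) * (\<Sum>k\<in>{- int N..int N}. w k * exp ((z k)\<^sup>2 * of_real t) * exp (- csqrt ((z k)\<^sup>2) * of_real r))"
        by (simp add: S_def sum_distrib_left)
      moreover have "G = \<i> * of_real (sqrt pi) * of_real (exp (- r\<^sup>2 / (4 * t)) / sqrt t)"
        by (simp add: G_def real_sqrt_divide)
      ultimately show ?thesis by (simp only: right_diff_distrib)
    qed
    ultimately have *: "sqrt pi * norm ((\<Sum>k\<in>{- int N..int N}. w k * exp ((z k)\<^sup>2 * of_real t) * exp (- csqrt ((z k)\<^sup>2) * of_real r))
             - of_real (exp (- r\<^sup>2 / (4 * t)) / sqrt t)) \<le> 9 * E" (is "_ * ?e \<le> _")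
      by (simp only: norm_mult norm_ii norm_of_real) simp
    have "1 * ?e \<le> sqrt pi * ?e"
      using pi_gt3 by (intro mult_right_mono) auto
    also note *
    \<comment> \<open>The errors \<open>4 * E\<close> and \<open>5 * E\<close> have been added. As
      \<open>9 \<le> exp 4 \<le> exp L\<close>, the constant uses up one of the two factors
      \<open>exp (- L)\<close> in \<open>E\<close>.\<close>
    also have "9 * E \<le> exp (- L) / sqrt t"
    proof -
      have "(9::real) \<le> 2 ^ 4" by simp
      also have "\<dots> \<le> exp 1 ^ 4" using exp_ge_add_one_self[of 1] by (intro power_mono) auto
      also have "\<dots> = exp 4" by (simp flip: exp_of_nat_mult)
      also have "\<dots> \<le> exp L" using L by simp
      finally have "9 * exp (- 2 * L) \<le> exp L * exp (- 2 * L)"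
        by (intro mult_right_mono) auto
      also have "\<dots> = exp (- L)" by (simp flip: exp_add)
      finally show ?thesis unfolding E_def using t by (simp add: divide_right_mono)
    qed
    finally show "?e \<le> exp (- L) / sqrt t" by simp
  qed (use N N_le s in auto)
qed

section \<open>The double layer heat kernel\<close>

text \<open>The total power \<open>d / 2 + 1\<close> of \<open>1 / t\<close> is split as
  \<open>(d + 1) / 2 + 1 / 2\<close>; the second part belongs to the profile that the contour
  integral produces.\<close>

lemma double_layer_heat_factor:
  fixes x y n :: "'a::euclidean_space"
  assumes t: "t > 0"
  shows "double_layer_heat x y n t = (1 / ((4 * pi) powr (real DIM('a) / 2) * 2)) * ((x - y) \<bullet> n) *
    (t powr (- ((real DIM('a) + 1) / 2)) * (exp (- (norm (x - y))\<^sup>2 / (4 * t)) / sqrt t))"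
proof -
  have "t powr (- ((real DIM('a) + 1) / 2)) / sqrt t = t powr (- ((real DIM('a) + 1) / 2) - 1 / 2)"
    using t by (simp add: powr_diff powr_half_sqrt)
  also have "- ((real DIM('a) + 1) / 2) - 1 / 2 = - (real DIM('a) / 2 + 1)"
    by (simp add: field_simps)
  also have "t powr \<dots> = 1 / (t powr (real DIM('a) / 2) * t)"
    using t by (simp only: powr_minus powr_add powr_one divide_inverse mult_1_left less_imp_le)
  finally have "t powr (- ((real DIM('a) + 1) / 2)) / sqrt t = 1 / (t powr (real DIM('a) / 2) * t)" .
  then have "(1 / ((4 * pi) powr (real DIM('a) / 2) * 2)) * ((x - y) \<bullet> n) * exp (- (norm (x - y))\<^sup>2 / (4 * t)) *
      (t powr (- ((real DIM('a) + 1) / 2)) / sqrt t)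
    = (1 / ((4 * pi) powr (real DIM('a) / 2) * 2)) * ((x - y) \<bullet> n) * exp (- (norm (x - y))\<^sup>2 / (4 * t)) *
      (1 / (t powr (real DIM('a) / 2) * t))" by (rule arg_cong)
  then show ?thesis
    using t by (simp add: double_layer_heat_def powr_mult mult_ac)
qed

text \<open>Write the difference as \<open>P (Q - q) + (P - p) q\<close> and use
  \<open>norm q \<le> 2 * M\<close>, which holds because \<open>\<eta> \<le> 1\<close>.\<close>

lemma norm_product_diff_le:
  fixes p P \<eta> :: real and q S Q :: complex
  assumes P: "0 \<le> P" "\<bar>p - P\<bar> \<le> \<eta> * P" and Q: "norm Q \<le> M" "norm (q - Q) \<le> \<eta> * M" and \<eta>: "0 \<le> \<eta>" "\<eta> \<le> 1"
  shows "norm (of_real P * Q - of_real p * q) \<le> 3 * \<eta> * (P * M)"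
proof -
  have M: "0 \<le> M" using Q(1) norm_ge_zero order_trans by blast
  have "\<eta> * M \<le> 1 * M" using \<eta> M by (intro mult_right_mono) auto
  then have q: "norm q \<le> 2 * M"
    using norm_triangle_sub[of q Q] Q by linarith
  have "of_real P * Q - of_real p * q = of_real P * (Q - q) + of_real (P - p) * q"
    by (simp add: algebra_simps)
  also have "norm \<dots> \<le> P * norm (q - Q) + \<bar>p - P\<bar> * norm q"
    using P by (intro order_trans[OF norm_triangle_ineq]) (simp only: norm_mult norm_of_real
        norm_minus_commute[of q Q] abs_minus_commute[of p P] abs_of_nonneg[OF P(1)] order_refl)
  also have "\<dots> \<le> P * (\<eta> * M) + (\<eta> * P) * (2 * M)"
    using P Q(2) q \<eta> by (intro add_mono mult_left_mono mult_mono) auto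
  also have "\<dots> = 3 * \<eta> * (P * M)" by simp
  finally show ?thesis .
qed

theorem theorem3:
  shows "\<exists>C>0. \<forall>(\<epsilon>::real) (R::real) (T::real) (\<delta>::real).
     0 < \<epsilon> \<and> \<epsilon> < 1/10 \<and> R > 1 \<and> 0 < \<delta> \<and> T \<ge> 1000 * \<delta> \<longrightarrow>
     (\<exists>(N1::nat) (N2::nat) (wt::nat \<Rightarrow> real) (lam::nat \<Rightarrow> real) (w::int \<Rightarrow> complex) (s::int \<Rightarrow> complex).
        N1 \<ge> 1 \<and> N2 \<ge> 1 \<and>
        real N1 \<le> C * ln (T / \<delta>) * (ln (1 / \<epsilon>) + ln (ln (T / \<delta>)) + ln R) \<and>
        real N2 \<le> C * (ln (1 / \<epsilon>) + ln R) * (ln (T / \<delta>) + ln (1 / \<epsilon>) + ln R) \<and>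
        (\<forall>j\<in>{1..N2}. wt j > 0 \<and> lam j > 0) \<and>
        (\<forall>k\<in>{- int N1..int N1}. \<not> (Im (s k) = 0 \<and> Re (s k) \<le> 0)) \<and>
        (\<forall>(x::'a::euclidean_space) y n t. norm (x - y) \<le> R \<and> norm n = 1 \<and> \<delta> \<le> t \<and> t \<le> T \<longrightarrow>
           cmod (complex_of_real (double_layer_heat x y n t)
                 - double_layer_approx N2 wt lam N1 w s x y n t)
             < \<epsilon> / t powr ((real DIM('a) + 2) / 2)))"
proof -
  define \<beta> where "\<beta> = (real DIM('a) + 1) / 2"
  have \<beta>: "\<beta> \<ge> 1" using DIM_positive[where 'a = 'a] by (simp add: \<beta>_def)
  obtain C2 K where C2: "C2 > 0" and K: "K > 0" and quad:
    "\<And>L \<delta> T. 1 \<le> L \<Longrightarrow> 0 < \<delta> \<Longrightarrow> \<delta> \<le> T \<Longrightarrow>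
       \<exists>N wt lam. N \<ge> (1::nat) \<and> real N \<le> C2 * L * (ln (T / \<delta>) + L) \<and>
         (\<forall>j. wt j > 0 \<and> lam j > 0) \<and>
         (\<forall>t. \<delta> \<le> t \<and> t \<le> T \<longrightarrow>
            \<bar>(\<Sum>j\<in>{1..N}. wt j * exp (- lam j * t)) - t powr (- \<beta>)\<bar> \<le> K * exp (- L) * t powr (- \<beta>))"
    by (rule powr_minus_quadrature[OF \<beta>]) (rule that, assumption+)
  define \<kappa> where "\<kappa> = 1 / ((4 * pi) powr (real DIM('a) / 2) * 2)"
  have \<kappa>: "0 < \<kappa>" "\<kappa> \<le> 1"
  proof -
    show "0 < \<kappa>" by (simp add: \<kappa>_def)
    have "1 \<le> (4 * pi) powr (real DIM('a) / 2)"
      using pi_gt3 by (intro ge_one_powr_ge_zero) auto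
    then show "\<kappa> \<le> 1" by (simp add: \<kappa>_def)
  qed
  \<comment> \<open>Raising the accuracy parameter from \<open>L\<close> to \<open>L + D\<close>
    absorbs the constant \<open>K\<close> of the power quadrature and leaves a factor 1/4.\<close>
  define D where "D = max 0 (ln (4 * K))"
  have D: "D \<ge> 0" "K * exp (- D) \<le> 1 / 4"
  proof -
    have "exp (- D) \<le> exp (- ln (4 * K))" by (simp add: D_def)
    also have "\<dots> = 1 / (4 * K)" using K by (subst exp_minus) (simp add: inverse_eq_divide)
    finally show "K * exp (- D) \<le> 1 / 4" using K by (simp add: field_simps)
  qed (simp add: D_def)
  \<comment> \<open>The 1000 is 200 times 5, from
    \<open>L + 4 + ln \<Lambda> \<le> 5 * (L + ln \<Lambda>)\<close> in the count \<open>N1\<close>.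
    In \<open>N2\<close>, replacing \<open>L\<close> by \<open>L + D\<close> costs one factor
    \<open>1 + D\<close> in each of the two factors.\<close>
  define C where "C = 1000 + C2 * (1 + D)\<^sup>2"
  have C: "C > 0" "1000 \<le> C" "C2 * (1 + D)\<^sup>2 \<le> C" using C2 by (auto simp: C_def add_pos_nonneg)
  show ?thesis
  proof (rule exI[of _ C], intro conjI allI impI C(1), elim conjE)
    fix \<epsilon> R T \<delta> :: real
    assume \<epsilon>: "0 < \<epsilon>" "\<epsilon> < 1 / 10" and R: "R > 1" and \<delta>: "0 < \<delta>" and T: "T \<ge> 1000 * \<delta>"
    \<comment> \<open>Chosen so that \<open>exp (- L) = \<epsilon> / R\<close>: the division by
      \<open>R\<close> offsets the factor \<open>(x - y) \<bullet> n\<close>, which can be as large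
      as \<open>R\<close>.\<close>
    define L where "L = ln (1 / \<epsilon>) + ln R"
    define \<Lambda> where "\<Lambda> = ln (T / \<delta>)"
    have T0: "\<delta> \<le> T" "T > 0" using \<delta> T by linarith+
    have ln_ge_1: "1 \<le> ln z" if "3 \<le> z" for z :: real
      using that exp_le by (subst ln_ge_iff) auto
    have "1 \<le> ln (1 / \<epsilon>)" using \<epsilon> by (intro ln_ge_1) (simp add: field_simps)
    moreover have "0 < ln R" using R by simp
    ultimately have L: "1 \<le> L" by (simp add: L_def)
    have exp_L: "exp (- L) = \<epsilon> / R"
    proof -
      have "L = ln (R / \<epsilon>)" using \<epsilon> R by (simp add: L_def ln_div)
      then have "exp L = R / \<epsilon>" using \<epsilon> R by simp
      then show ?thesis unfolding exp_minus by simp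
    qed
    have \<Lambda>: "1 \<le> \<Lambda>" unfolding \<Lambda>_def using \<delta> T by (intro ln_ge_1) (simp add: field_simps)
    \<comment> \<open>The shift by 4 meets the lower bound required for the profile and gains
      \<open>exp (- 4) \<le> 1 / 4\<close>.\<close>
    have L4: "4 \<le> L + 4" using L by simp
    obtain N1 w s where N1: "N1 \<ge> 1" "real N1 \<le> 200 * \<Lambda> * (L + 4 + ln \<Lambda>)"
      and s: "\<And>k. \<not> (Im (s k) = 0 \<and> Re (s k) \<le> 0)"
      and profile: "\<And>r t. 0 \<le> r \<Longrightarrow> \<delta> \<le> t \<Longrightarrow> t \<le> T \<Longrightarrow>
       cmod ((\<Sum>k\<in>{- int N1..int N1}. w k * exp (s k * of_real t) * exp (- csqrt (s k) * of_real r))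
             - of_real (exp (- r\<^sup>2 / (4 * t)) / sqrt t)) \<le> exp (- (L + 4)) / sqrt t"
      by (rule heat_profile_approx[OF L4 \<delta> T, folded \<Lambda>_def]) (rule that, assumption+)
    have LD: "1 \<le> L + D" using L D(1) by simp
    obtain N2 wt lam where N2: "N2 \<ge> 1" "real N2 \<le> C2 * (L + D) * (\<Lambda> + (L + D))"
      and pos: "\<And>j. wt j > 0" "\<And>j. lam j > 0"
      and power: "\<And>t. \<delta> \<le> t \<Longrightarrow> t \<le> T \<Longrightarrow>
        \<bar>(\<Sum>j\<in>{1..N2}. wt j * exp (- lam j * t)) - t powr (- \<beta>)\<bar> \<le> K * exp (- (L + D)) * t powr (- \<beta>)"
      using quad[OF LD \<delta> T0(1), folded \<Lambda>_def] by blast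
    have N1_le: "real N1 \<le> C * \<Lambda> * (L + ln \<Lambda>)"
    proof -
      have nonneg: "0 \<le> \<Lambda> * (L + ln \<Lambda>)" using \<Lambda> L by (intro mult_nonneg_nonneg add_nonneg_nonneg) auto
      have "L + 4 + ln \<Lambda> \<le> 5 * (L + ln \<Lambda>)" using L ln_ge_zero[OF \<Lambda>] by (simp only: distrib_left)
      then have "200 * \<Lambda> * (L + 4 + ln \<Lambda>) \<le> 200 * \<Lambda> * (5 * (L + ln \<Lambda>))"
        using \<Lambda> by (intro mult_left_mono) auto
      also have "\<dots> = 1000 * (\<Lambda> * (L + ln \<Lambda>))" by simp
      also have "\<dots> \<le> C * (\<Lambda> * (L + ln \<Lambda>))" using C(2) nonneg by (rule mult_right_mono)
      finally show ?thesis using N1(2) by (simp add: mult.assoc)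
    qed
    have N2_le: "real N2 \<le> C * L * (\<Lambda> + L)"
    proof -
      have "D * 1 \<le> D * L" "D * 1 \<le> D * (\<Lambda> + L)"
        using D(1) L \<Lambda> by (intro mult_left_mono; simp)+
      then have le: "L + D \<le> (1 + D) * L" "\<Lambda> + (L + D) \<le> (1 + D) * (\<Lambda> + L)"
        by (simp_all add: distrib_right)
      have "C2 * (L + D) * (\<Lambda> + (L + D)) = C2 * ((L + D) * (\<Lambda> + (L + D)))" by simp
      also have "\<dots> \<le> C2 * (((1 + D) * L) * ((1 + D) * (\<Lambda> + L)))"
        using C2 le D(1) L \<Lambda> by (intro mult_left_mono mult_mono[OF le]) auto
      also have "\<dots> = (C2 * (1 + D)\<^sup>2) * (L * (\<Lambda> + L))" by (simp add: power2_eq_square)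
      also have "\<dots> \<le> C * (L * (\<Lambda> + L))" using C(3) L \<Lambda> by (intro mult_right_mono) auto
      finally show ?thesis using N2(2) by (simp add: mult.assoc)
    qed
    \<comment> \<open>The positive normalisation \<open>\<kappa>\<close> is put into the real
      weights. Both factors have relative error \<open>exp (- L) / 4\<close>, so the product error
      is at most 3/4 of the tolerance, which makes the inequality strict.\<close>
    have approx: "cmod (complex_of_real (double_layer_heat x y n t)
                 - double_layer_approx N2 (\<lambda>j. \<kappa> * wt j) lam N1 w s x y n t)
             < \<epsilon> / t powr ((real DIM('a) + 2) / 2)"
      if xy: "norm (x - y) \<le> R" and n: "norm n = 1" and t\<delta>: "\<delta> \<le> t" and tT: "t \<le> T"
      for x y n :: 'a and t
    proof -
      have t: "t > 0" using t\<delta> \<delta> by simp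
      define r where "r = norm (x - y)"
      define S1 where "S1 = (\<Sum>k\<in>{- int N1..int N1}. w k * exp (s k * of_real t) * exp (- csqrt (s k) * of_real r))"
      define S2 where "S2 = (\<Sum>j\<in>{1..N2}. wt j * exp (- lam j * t))"
      define P where "P = t powr (- \<beta>)"
      define Q where "Q = exp (- r\<^sup>2 / (4 * t)) / sqrt t"
      define p where "p = (x - y) \<bullet> n"
      have P: "P > 0" using t by (simp add: P_def)
      have p: "\<bar>p\<bar> \<le> R"
        using Cauchy_Schwarz_ineq2[of "x - y" n] n xy by (simp add: p_def)
      have heat: "double_layer_heat x y n t = \<kappa> * p * (P * Q)"
        using double_layer_heat_factor[OF t, of x y n]
        by (simp only: \<kappa>_def p_def P_def Q_def r_def \<beta>_def)
      have inner: "(\<Sum>k\<in>{- int N1..int N1}. w k * exp (s k * of_real t) * exp (- csqrt (s k) * of_real r) * of_real p)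
          = S1 * of_real p"
        by (simp only: S1_def sum_distrib_right)
      have "double_layer_approx N2 (\<lambda>j. \<kappa> * wt j) lam N1 w s x y n t
          = (\<Sum>j\<in>{1..N2}. of_real (\<kappa> * wt j * exp (- lam j * t)) * (S1 * of_real p))"
        by (simp only: double_layer_approx_def r_def[symmetric] p_def[symmetric] inner)
      also have "\<dots> = of_real (\<Sum>j\<in>{1..N2}. \<kappa> * wt j * exp (- lam j * t)) * (S1 * of_real p)"
        by (simp only: of_real_sum sum_distrib_right)
      also have "(\<Sum>j\<in>{1..N2}. \<kappa> * wt j * exp (- lam j * t)) = \<kappa> * S2"
        by (simp only: S2_def sum_distrib_left mult.assoc)
      also have "of_real (\<kappa> * S2) * (S1 * of_real p) = of_real (\<kappa> * p) * (of_real S2 * S1)"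
        by simp
      finally have "complex_of_real (double_layer_heat x y n t)
          - double_layer_approx N2 (\<lambda>j. \<kappa> * wt j) lam N1 w s x y n t
        = of_real (\<kappa> * p) * (of_real P * of_real Q - of_real S2 * S1)"
        unfolding heat by (simp add: right_diff_distrib)
      then have "cmod (complex_of_real (double_layer_heat x y n t)
          - double_layer_approx N2 (\<lambda>j. \<kappa> * wt j) lam N1 w s x y n t)
        = \<bar>\<kappa> * p\<bar> * cmod (of_real P * of_real Q - of_real S2 * S1)"
        by (simp only: norm_mult norm_of_real)
      also have "\<dots> \<le> R * (3 * (exp (- L) / 4) * (P * (1 / sqrt t)))"
      proof (rule mult_mono)
        have "\<bar>\<kappa> * p\<bar> \<le> 1 * R" unfolding abs_mult using \<kappa> p R by (intro mult_mono) auto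
        then show "\<bar>\<kappa> * p\<bar> \<le> R" by simp
        show "cmod (of_real P * of_real Q - of_real S2 * S1) \<le> 3 * (exp (- L) / 4) * (P * (1 / sqrt t))"
        proof (rule norm_product_diff_le)
          have "\<bar>S2 - P\<bar> \<le> (K * exp (- D)) * (exp (- L) * P)"
          proof -
            have "exp (- (L + D)) = exp (- D) * exp (- L)" by (simp flip: exp_add)
            then show ?thesis
              using power[OF t\<delta> tT] by (simp only: S2_def P_def mult.assoc)
          qed
          also have "\<dots> \<le> (1 / 4) * (exp (- L) * P)"
            using D(2) P by (intro mult_right_mono) auto
          finally show "\<bar>S2 - P\<bar> \<le> exp (- L) / 4 * P" by simp
          show "norm (of_real Q :: complex) \<le> 1 / sqrt t"
            using t unfolding norm_of_real Q_def by (simp add: divide_right_mono)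
          have "(4::real) \<le> exp 4" using exp_ge_add_one_self[of "4::real"] by linarith
          then have "exp (- 4 :: real) \<le> 1 / 4"
            unfolding exp_minus by (simp add: inverse_eq_divide divide_le_eq)
          then have "exp (- L) * exp (- 4) \<le> exp (- L) * (1 / 4)" by (intro mult_left_mono) auto
          then have "exp (- (L + 4)) \<le> exp (- L) / 4" by (simp flip: exp_add)
          then have "exp (- (L + 4)) / sqrt t \<le> exp (- L) / 4 / sqrt t"
            using t by (intro divide_right_mono) auto
          then show "norm (S1 - of_real Q) \<le> exp (- L) / 4 * (1 / sqrt t)"
            using profile[OF norm_ge_zero t\<delta> tT, of "x - y"] unfolding S1_def Q_def r_def by simp
          have "exp (- L) \<le> 1" using L by simp
          then show "exp (- L) / 4 \<le> 1" by linarith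
        qed (use P in auto)
      qed (use R in auto)
      also have "\<dots> = 3 / 4 * \<epsilon> * (P / sqrt t)"
        unfolding exp_L using R by simp
      also have "P / sqrt t = 1 / t powr ((real DIM('a) + 2) / 2)"
      proof -
        have "P / sqrt t = t powr (- \<beta> - 1 / 2)"
          using t by (simp add: P_def powr_diff powr_half_sqrt)
        also have "- \<beta> - 1 / 2 = - ((real DIM('a) + 2) / 2)"
          by (simp add: \<beta>_def field_simps)
        finally show ?thesis by (simp only: powr_minus_divide)
      qed
      also have "3 / 4 * \<epsilon> * (1 / t powr ((real DIM('a) + 2) / 2)) < \<epsilon> * (1 / t powr ((real DIM('a) + 2) / 2))"
        using \<epsilon> t by (intro mult_strict_right_mono) auto
      finally show ?thesis by simp
    qed
    show "\<exists>(N1::nat) (N2::nat) (wt::nat \<Rightarrow> real) (lam::nat \<Rightarrow> real) (w::int \<Rightarrow> complex) (s::int \<Rightarrow> complex).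
        N1 \<ge> 1 \<and> N2 \<ge> 1 \<and>
        real N1 \<le> C * ln (T / \<delta>) * (ln (1 / \<epsilon>) + ln (ln (T / \<delta>)) + ln R) \<and>
        real N2 \<le> C * (ln (1 / \<epsilon>) + ln R) * (ln (T / \<delta>) + ln (1 / \<epsilon>) + ln R) \<and>
        (\<forall>j\<in>{1..N2}. wt j > 0 \<and> lam j > 0) \<and>
        (\<forall>k\<in>{- int N1..int N1}. \<not> (Im (s k) = 0 \<and> Re (s k) \<le> 0)) \<and>
        (\<forall>(x::'a::euclidean_space) y n t. norm (x - y) \<le> R \<and> norm n = 1 \<and> \<delta> \<le> t \<and> t \<le> T \<longrightarrow>
           cmod (complex_of_real (double_layer_heat x y n t)
                 - double_layer_approx N2 wt lam N1 w s x y n t)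
             < \<epsilon> / t powr ((real DIM('a) + 2) / 2))"
    proof (intro exI conjI)
      show "real N1 \<le> C * ln (T / \<delta>) * (ln (1 / \<epsilon>) + ln (ln (T / \<delta>)) + ln R)"
        using N1_le by (simp only: L_def \<Lambda>_def add_ac)
      show "real N2 \<le> C * (ln (1 / \<epsilon>) + ln R) * (ln (T / \<delta>) + ln (1 / \<epsilon>) + ln R)"
        using N2_le by (simp only: L_def \<Lambda>_def add_ac)
      show "\<forall>j\<in>{1..N2}. \<kappa> * wt j > 0 \<and> lam j > 0" using \<kappa> pos by simp
      show "\<forall>k\<in>{- int N1..int N1}. \<not> (Im (s k) = 0 \<and> Re (s k) \<le> 0)" using s by blast
    qed (use N1(1) N2(1) approx in blast)+
  qed
qed

end
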